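(* A Lie algebra $2$-cocycle valued in the ground field with trivial representation gives rise to a shelf $2$-cocycle, as follows. Let $\mathfrak g$ be a Lie algebra over a field $k$ of characteristic other than $2$ and let $\psi:\mathfrak g\times\mathfrak g\to k$ be a bilinear map with $\psi(y,x)=-\psi(x,y)$ and $\psi([x,y],z)+\psi([y,z],x)+\psi([z,x],y)=0$ for all $x,y,z\in\mathfrak g$. Let $\mathfrak g'=k\gamma\oplus\mathfrak g$ be the Lie algebra with bracket $[a\gamma+x,b\gamma+y]'=[x,y]\in\mathfrak g\subset\mathfrak g'$, and define $\psi':\mathfrak g'\times\mathfrak g'\to\mathfrak g'$ by $\psi'(a\gamma+x,b\gamma+y)=\psi(x,y)\gamma$. Let $N'=k\oplus\mathfrak g'$ with its coalgebra structure and map $q$ described in the context, and define the linear map $\widehat{\psi'}:N'\otimes N'\to N'$ by $\widehat{\psi'}((a+u)\otimes(b+v))=\psi'(u,v)$ for $a,b\in k$, $u,v\in\mathfrak g'$. Then $\widehat{\psi'}$ is a shelf $2$-cocycle: $d^{2,1}(\widehat{\psi'},0)=d^{2,2}(\widehat{\psi'},0)=0$.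
   Context: $N'=k\oplus\mathfrak g'$ is the cocommutative coalgebra with $\Delta(1)=1\otimes 1$, $\Delta(u)=u\otimes 1+1\otimes u$, $\epsilon(1)=1$, $\epsilon(u)=0$ for $u\in\mathfrak g'$, and $q:N'\otimes N'\to N'$ is the linear map $q((a+u)\otimes(b+v))=ab+bu+[u,v]'$. For linear $\eta:N'\otimes N'\to N'$, with $\tau$ the flip and $\tau_2=1\otimes\tau\otimes 1$: $$d^{2,1}(\eta,0)=q(\eta\otimes 1)+\eta(q\otimes 1)-\big[\eta(q\otimes q)+q(\eta\otimes q)+q(q\otimes\eta)\big]\tau_2(1\otimes 1\otimes\Delta),$$ $$d^{2,2}(\eta,0)=\Delta\eta-\big[(\eta\otimes q)+(q\otimes\eta)\big]\tau_2(\Delta\otimes\Delta).$$ *)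

theory Defs
  imports "HOL-Algebra.Module" "HOL-Algebra.QuotRing"
begin

section \<open>Linear and bilinear maps\<close>

text \<open>
  Spaces over a field \<open>K\<close> are modules in the sense of the locale \<^locale>\<open>module\<close>.  That locale does
  not look at the fields \<open>mult\<close> and \<open>one\<close> which a module record inherits from rings; they are left
  \<^const>\<open>undefined\<close> below.
\<close>

definition linear_maps ::
  "('k, 'r) ring_scheme \<Rightarrow> ('k, 'm, 'c) module_scheme \<Rightarrow> ('k, 'n, 'd) module_scheme \<Rightarrow> ('m \<Rightarrow> 'n) set"
  where "linear_maps K M N = {f. f \<in> carrier M \<rightarrow> carrier N \<and>
     (\<forall>x\<in>carrier M. \<forall>y\<in>carrier M. f (x \<oplus>\<^bsub>M\<^esub> y) = f x \<oplus>\<^bsub>N\<^esub> f y) \<and>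
     (\<forall>r\<in>carrier K. \<forall>x\<in>carrier M. f (r \<odot>\<^bsub>M\<^esub> x) = r \<odot>\<^bsub>N\<^esub> f x)}"

definition bilinear_maps ::
  "('k, 'r) ring_scheme \<Rightarrow> ('k, 'm, 'c) module_scheme \<Rightarrow> ('k, 'n, 'd) module_scheme \<Rightarrow>
   ('k, 'p, 'e) module_scheme \<Rightarrow> ('m \<Rightarrow> 'n \<Rightarrow> 'p) set"
  where "bilinear_maps K M N P = {b.
     (\<forall>x\<in>carrier M. b x \<in> linear_maps K N P) \<and>
     (\<forall>y\<in>carrier N. (\<lambda>x. b x y) \<in> linear_maps K M P)}"

definition scalar_module :: "('k, 'r) ring_scheme \<Rightarrow> ('k, 'k) module"
  where "scalar_module K = \<lparr>carrier = carrier K, mult = undefined, one = undefined,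
     zero = \<zero>\<^bsub>K\<^esub>, add = (\<lambda>x y. x \<oplus>\<^bsub>K\<^esub> y), smult = (\<lambda>r x. r \<otimes>\<^bsub>K\<^esub> x)\<rparr>"

definition direct_sum_module ::
  "('k, 'm, 'c) module_scheme \<Rightarrow> ('k, 'n, 'd) module_scheme \<Rightarrow> ('k, 'm \<times> 'n) module"
  where "direct_sum_module M N = \<lparr>carrier = carrier M \<times> carrier N, mult = undefined, one = undefined,
     zero = (\<zero>\<^bsub>M\<^esub>, \<zero>\<^bsub>N\<^esub>),
     add = (\<lambda>(x, y) (x', y'). (x \<oplus>\<^bsub>M\<^esub> x', y \<oplus>\<^bsub>N\<^esub> y')),
     smult = (\<lambda>r (x, y). (r \<odot>\<^bsub>M\<^esub> x, r \<odot>\<^bsub>N\<^esub> y))\<rparr>"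


section \<open>Tensor products\<close>

text \<open>
  The tensor product is the quotient of the free module on pairs by the submodule generated by the
  bilinearity relations; its elements are cosets, as for \<^const>\<open>FactRing\<close>.
\<close>

definition free_module :: "('k, 'r) ring_scheme \<Rightarrow> 's set \<Rightarrow> ('k, 's \<Rightarrow> 'k) module"
  where "free_module K S =
     \<lparr>carrier = {f. (\<forall>x. f x \<in> carrier K) \<and> (\<forall>x. x \<notin> S \<longrightarrow> f x = \<zero>\<^bsub>K\<^esub>) \<and> finite {x. f x \<noteq> \<zero>\<^bsub>K\<^esub>}},
      mult = undefined, one = undefined, zero = (\<lambda>x. \<zero>\<^bsub>K\<^esub>),
      add = (\<lambda>f g x. f x \<oplus>\<^bsub>K\<^esub> g x), smult = (\<lambda>r f x. r \<otimes>\<^bsub>K\<^esub> f x)\<rparr>"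

definition free_gen :: "('k, 'r) ring_scheme \<Rightarrow> 's \<Rightarrow> 's \<Rightarrow> 'k"
  where "free_gen K s = (\<lambda>x. if x = s then \<one>\<^bsub>K\<^esub> else \<zero>\<^bsub>K\<^esub>)"

definition generated_submodule ::
  "('k, 'r) ring_scheme \<Rightarrow> ('k, 'm, 'c) module_scheme \<Rightarrow> 'm set \<Rightarrow> 'm set"
  where "generated_submodule K M A = \<Inter>{H. submodule H K M \<and> A \<subseteq> H}"

definition quotient_module :: "('k, 'm, 'c) module_scheme \<Rightarrow> 'm set \<Rightarrow> ('k, 'm set) module"
  where "quotient_module M H =
     \<lparr>carrier = a_rcosets\<^bsub>M\<^esub> H, mult = undefined, one = undefined, zero = H, add = set_add M,
      smult = (\<lambda>r X. \<Union>x\<in>X. H +>\<^bsub>M\<^esub> (r \<odot>\<^bsub>M\<^esub> x))\<rparr>"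

definition tensor_relations ::
  "('k, 'r) ring_scheme \<Rightarrow> ('k, 'm, 'c) module_scheme \<Rightarrow> ('k, 'n, 'd) module_scheme \<Rightarrow> ('m \<times> 'n \<Rightarrow> 'k) set"
  where "tensor_relations K M N =
     (let F = free_module K (carrier M \<times> carrier N); e = (\<lambda>x y. free_gen K (x, y)) in
       {e (x \<oplus>\<^bsub>M\<^esub> x') y \<ominus>\<^bsub>F\<^esub> (e x y \<oplus>\<^bsub>F\<^esub> e x' y) | x x' y.
           x \<in> carrier M \<and> x' \<in> carrier M \<and> y \<in> carrier N} \<union>
       {e x (y \<oplus>\<^bsub>N\<^esub> y') \<ominus>\<^bsub>F\<^esub> (e x y \<oplus>\<^bsub>F\<^esub> e x y') | x y y'.
           x \<in> carrier M \<and> y \<in> carrier N \<and> y' \<in> carrier N} \<union>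
       {e (r \<odot>\<^bsub>M\<^esub> x) y \<ominus>\<^bsub>F\<^esub> r \<odot>\<^bsub>F\<^esub> e x y | r x y.
           r \<in> carrier K \<and> x \<in> carrier M \<and> y \<in> carrier N} \<union>
       {e x (r \<odot>\<^bsub>N\<^esub> y) \<ominus>\<^bsub>F\<^esub> r \<odot>\<^bsub>F\<^esub> e x y | r x y.
           r \<in> carrier K \<and> x \<in> carrier M \<and> y \<in> carrier N})"

definition tensor_kernel ::
  "('k, 'r) ring_scheme \<Rightarrow> ('k, 'm, 'c) module_scheme \<Rightarrow> ('k, 'n, 'd) module_scheme \<Rightarrow> ('m \<times> 'n \<Rightarrow> 'k) set"
  where "tensor_kernel K M N =
     generated_submodule K (free_module K (carrier M \<times> carrier N)) (tensor_relations K M N)"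

definition tensor_module ::
  "('k, 'r) ring_scheme \<Rightarrow> ('k, 'm, 'c) module_scheme \<Rightarrow> ('k, 'n, 'd) module_scheme \<Rightarrow>
   ('k, ('m \<times> 'n \<Rightarrow> 'k) set) module"
  where "tensor_module K M N =
     quotient_module (free_module K (carrier M \<times> carrier N)) (tensor_kernel K M N)"

definition pure_tensor ::
  "('k, 'r) ring_scheme \<Rightarrow> ('k, 'm, 'c) module_scheme \<Rightarrow> ('k, 'n, 'd) module_scheme \<Rightarrow>
   'm \<Rightarrow> 'n \<Rightarrow> ('m \<times> 'n \<Rightarrow> 'k) set"
  where "pure_tensor K M N x y =
     tensor_kernel K M N +>\<^bsub>free_module K (carrier M \<times> carrier N)\<^esub> free_gen K (x, y)"

text \<open>
  \<open>tensor_lift K P b\<close> is the linear map \<open>M \<otimes> N \<rightarrow> P\<close> induced by a bilinear map \<open>b\<close>: the linear extension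
  of \<open>b\<close> to the free module is constant on each coset, and its value there is the result.  Lemma
  \<open>tensor_lift\<close> below states that this is well defined.
\<close>

definition free_ext ::
  "('k, 'r) ring_scheme \<Rightarrow> ('k, 'p, 'e) module_scheme \<Rightarrow> ('m \<Rightarrow> 'n \<Rightarrow> 'p) \<Rightarrow> ('m \<times> 'n \<Rightarrow> 'k) \<Rightarrow> 'p"
  where "free_ext K P b f = (\<Oplus>\<^bsub>P\<^esub>z\<in>{z. f z \<noteq> \<zero>\<^bsub>K\<^esub>}. f z \<odot>\<^bsub>P\<^esub> b (fst z) (snd z))"

definition tensor_lift ::
  "('k, 'r) ring_scheme \<Rightarrow> ('k, 'p, 'e) module_scheme \<Rightarrow> ('m \<Rightarrow> 'n \<Rightarrow> 'p) \<Rightarrow> ('m \<times> 'n \<Rightarrow> 'k) set \<Rightarrow> 'p"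
  where "tensor_lift K P b X = the_elem (free_ext K P b ` X)"

text \<open>\<open>tensor_map K M' N' f g\<close> is \<open>f \<otimes> g\<close> for linear maps \<open>f\<close> into \<open>M'\<close> and \<open>g\<close> into \<open>N'\<close>.\<close>

definition tensor_map ::
  "('k, 'r) ring_scheme \<Rightarrow> ('k, 'm2, 'c) module_scheme \<Rightarrow> ('k, 'n2, 'd) module_scheme \<Rightarrow>
   ('m1 \<Rightarrow> 'm2) \<Rightarrow> ('n1 \<Rightarrow> 'n2) \<Rightarrow> ('m1 \<times> 'n1 \<Rightarrow> 'k) set \<Rightarrow> ('m2 \<times> 'n2 \<Rightarrow> 'k) set"
  where "tensor_map K M' N' f g =
     tensor_lift K (tensor_module K M' N') (\<lambda>x y. pure_tensor K M' N' (f x) (g y))"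

definition tensor_flip ::
  "('k, 'r) ring_scheme \<Rightarrow> ('k, 'm, 'c) module_scheme \<Rightarrow> ('k, 'n, 'd) module_scheme \<Rightarrow>
   ('m \<times> 'n \<Rightarrow> 'k) set \<Rightarrow> ('n \<times> 'm \<Rightarrow> 'k) set"
  where "tensor_flip K M N =
     tensor_lift K (tensor_module K N M) (\<lambda>x y. pure_tensor K N M y x)"

text \<open>The canonical isomorphism \<open>(A \<otimes> B) \<otimes> C \<rightarrow> A \<otimes> (B \<otimes> C)\<close> and its inverse.\<close>

definition tensor_assoc ::
  "('k, 'r) ring_scheme \<Rightarrow> ('k, 'a, 'c1) module_scheme \<Rightarrow> ('k, 'b, 'c2) module_scheme \<Rightarrow>
   ('k, 'c, 'c3) module_scheme \<Rightarrow>
   (('a \<times> 'b \<Rightarrow> 'k) set \<times> 'c \<Rightarrow> 'k) set \<Rightarrow> ('a \<times> ('b \<times> 'c \<Rightarrow> 'k) set \<Rightarrow> 'k) set"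
  where "tensor_assoc K A B C =
     (let BC = tensor_module K B C; T = tensor_module K A BC in
       tensor_lift K T (\<lambda>s z.
         tensor_lift K T (\<lambda>x y. pure_tensor K A BC x (pure_tensor K B C y z)) s))"

definition tensor_assoc_inv ::
  "('k, 'r) ring_scheme \<Rightarrow> ('k, 'a, 'c1) module_scheme \<Rightarrow> ('k, 'b, 'c2) module_scheme \<Rightarrow>
   ('k, 'c, 'c3) module_scheme \<Rightarrow>
   ('a \<times> ('b \<times> 'c \<Rightarrow> 'k) set \<Rightarrow> 'k) set \<Rightarrow> (('a \<times> 'b \<Rightarrow> 'k) set \<times> 'c \<Rightarrow> 'k) set"
  where "tensor_assoc_inv K A B C =
     (let AB = tensor_module K A B; T = tensor_module K AB C in
       tensor_lift K T (\<lambda>x s.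
         tensor_lift K T (\<lambda>y z. pure_tensor K AB C (pure_tensor K A B x y) z) s))"

text \<open>
  \<open>\<tau>\<^sub>2 = 1 \<otimes> \<tau> \<otimes> 1\<close> on the fourfold tensor power of \<open>N\<close>, bracketed as \<open>(N \<otimes> N) \<otimes> (N \<otimes> N)\<close>: rebracket to
  \<open>N \<otimes> ((N \<otimes> N) \<otimes> N)\<close>, apply \<open>1 \<otimes> (\<tau> \<otimes> 1)\<close>, and rebracket back.
\<close>

definition tensor_flip2 ::
  "('k, 'r) ring_scheme \<Rightarrow> ('k, 'n, 'd) module_scheme \<Rightarrow>
   (('n \<times> 'n \<Rightarrow> 'k) set \<times> ('n \<times> 'n \<Rightarrow> 'k) set \<Rightarrow> 'k) set \<Rightarrow>
   (('n \<times> 'n \<Rightarrow> 'k) set \<times> ('n \<times> 'n \<Rightarrow> 'k) set \<Rightarrow> 'k) set"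
  where "tensor_flip2 K N =
     (let NN = tensor_module K N N; N3 = tensor_module K N NN; N3' = tensor_module K NN N in
       tensor_assoc_inv K N N NN
       \<circ> tensor_map K N N3 id (tensor_assoc K N N N)
       \<circ> tensor_map K N N3' id (tensor_map K NN N (tensor_flip K N N) id)
       \<circ> tensor_map K N N3' id (tensor_assoc_inv K N N N)
       \<circ> tensor_assoc K N N NN)"


subsection \<open>The universal property\<close>

lemma linear_mapsI:
  assumes "\<And>x. x \<in> carrier M \<Longrightarrow> f x \<in> carrier N"
    and "\<And>x y. \<lbrakk>x \<in> carrier M; y \<in> carrier M\<rbrakk> \<Longrightarrow> f (x \<oplus>\<^bsub>M\<^esub> y) = f x \<oplus>\<^bsub>N\<^esub> f y"
    and "\<And>r x. \<lbrakk>r \<in> carrier K; x \<in> carrier M\<rbrakk> \<Longrightarrow> f (r \<odot>\<^bsub>M\<^esub> x) = r \<odot>\<^bsub>N\<^esub> f x"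
  shows "f \<in> linear_maps K M N"
  using assms by (auto simp: linear_maps_def)

lemma free_module_module:
  fixes K :: "('k, 'r) ring_scheme" and S :: "'s set"
  assumes "cring K" shows "module K (free_module K S)"
proof -
  interpret cring K by fact
  have fin: "finite {x. f x \<oplus>\<^bsub>K\<^esub> g x \<noteq> \<zero>\<^bsub>K\<^esub>}" if "finite {x. f x \<noteq> \<zero>\<^bsub>K\<^esub>}" "finite {x. g x \<noteq> \<zero>\<^bsub>K\<^esub>}" for f g :: "'s \<Rightarrow> 'k"
    by (rule finite_subset[OF _ finite_UnI[OF that]]) auto
  have fin2: "finite {x. r \<otimes>\<^bsub>K\<^esub> f x \<noteq> \<zero>\<^bsub>K\<^esub>}" if "r \<in> carrier K" "finite {x. f x \<noteq> \<zero>\<^bsub>K\<^esub>}" for r and f :: "'s \<Rightarrow> 'k"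
    by (rule finite_subset[OF _ that(2)]) (use that in auto)
  have fin3: "finite {x. \<ominus>\<^bsub>K\<^esub> f x \<noteq> \<zero>\<^bsub>K\<^esub>}" if "finite {x. f x \<noteq> \<zero>\<^bsub>K\<^esub>}" for f :: "'s \<Rightarrow> 'k"
    by (rule finite_subset[OF _ that(1)]) (use that in auto)
  have ag: "abelian_group (free_module K S)"
  proof (rule abelian_groupI)
    fix x assume x: "x \<in> carrier (free_module K S)"
    then have "(\<lambda>z. \<ominus>\<^bsub>K\<^esub> x z) \<in> carrier (free_module K S) \<and> (\<lambda>z. \<ominus>\<^bsub>K\<^esub> x z) \<oplus>\<^bsub>free_module K S\<^esub> x = \<zero>\<^bsub>free_module K S\<^esub>"
      by (auto simp: free_module_def fin3 l_neg)
    then show "\<exists>y\<in>carrier (free_module K S). y \<oplus>\<^bsub>free_module K S\<^esub> x = \<zero>\<^bsub>free_module K S\<^esub>" by blast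
  qed (auto simp: free_module_def fin fun_eq_iff a_assoc intro: a_comm)
  show ?thesis
    by (rule moduleI[OF \<open>cring K\<close> ag])
       (auto simp: free_module_def fin2 fun_eq_iff l_distr r_distr m_assoc)
qed

lemma generated_submodule:
  assumes "module K M" "A \<subseteq> carrier M"
  shows "submodule (generated_submodule K M A) K M" "A \<subseteq> generated_submodule K M A"
proof -
  interpret module K M by fact
  have sub: "carrier M \<in> {H. submodule H K M \<and> A \<subseteq> H}" using carrier_is_submodule assms by auto
  show "submodule (generated_submodule K M A) K M"
    unfolding generated_submodule_def
  proof (rule submoduleI)
    show "\<Inter> {H. submodule H K M \<and> A \<subseteq> H} \<subseteq> carrier M" using sub by blast
    show "\<zero>\<^bsub>M\<^esub> \<in> \<Inter> {H. submodule H K M \<and> A \<subseteq> H}"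
      using submodule.axioms(1) subgroup.one_closed by fastforce
  qed (auto dest: submoduleE)
  show "A \<subseteq> generated_submodule K M A" by (auto simp: generated_submodule_def)
qed

lemma quotient_module:
  assumes "module K M" "submodule H K M"
  shows "module K (quotient_module M H)"
    "(\<lambda>x. H +>\<^bsub>M\<^esub> x) \<in> linear_maps K M (quotient_module M H)"
proof -
  interpret module K M by fact
  interpret H: abelian_subgroup H M
    using assms(2) M.abelian_group_axioms
    by (intro abelian_subgroupI3) (auto simp: additive_subgroup_def submodule_def)
  have carr: "carrier (quotient_module M H) = (\<lambda>x. H +>\<^bsub>M\<^esub> x) ` carrier M"
    by (auto simp: quotient_module_def A_RCOSETS_def RCOSETS_def a_r_coset_def)
  have add: "(H +>\<^bsub>M\<^esub> x) \<oplus>\<^bsub>quotient_module M H\<^esub> (H +>\<^bsub>M\<^esub> y) = H +>\<^bsub>M\<^esub> (x \<oplus>\<^bsub>M\<^esub> y)"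
    if "x \<in> carrier M" "y \<in> carrier M" for x y
    using that by (simp add: quotient_module_def H.a_rcos_sum)
  have sm: "r \<odot>\<^bsub>quotient_module M H\<^esub> (H +>\<^bsub>M\<^esub> x) = H +>\<^bsub>M\<^esub> (r \<odot>\<^bsub>M\<^esub> x)"
    if r: "r \<in> carrier K" and x: "x \<in> carrier M" for r x
  proof -
    have *: "H +>\<^bsub>M\<^esub> (r \<odot>\<^bsub>M\<^esub> y) = H +>\<^bsub>M\<^esub> (r \<odot>\<^bsub>M\<^esub> x)" if "y \<in> H +>\<^bsub>M\<^esub> x" for y
    proof -
      obtain h where h: "h \<in> H" "y = h \<oplus>\<^bsub>M\<^esub> x" using \<open>y \<in> _\<close> by (auto simp: a_r_coset_def r_coset_def)
      then have hc: "h \<in> carrier M" using H.a_subset by auto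
      have "r \<odot>\<^bsub>M\<^esub> y = r \<odot>\<^bsub>M\<^esub> h \<oplus>\<^bsub>M\<^esub> r \<odot>\<^bsub>M\<^esub> x" using h hc r x by (simp add: smult_r_distr)
      moreover have "r \<odot>\<^bsub>M\<^esub> h \<in> H" using h r submodule.smult_closed[OF assms(2)] by simp
      ultimately have "r \<odot>\<^bsub>M\<^esub> y \<in> H +>\<^bsub>M\<^esub> (r \<odot>\<^bsub>M\<^esub> x)" by (auto simp: a_r_coset_def r_coset_def)
      from M.a_repr_independence[OF this _ H.a_subgroup] show ?thesis using r x by simp
    qed
    moreover have "x \<in> H +>\<^bsub>M\<^esub> x" using x H.a_rcos_self by simp
    ultimately have "(\<Union>y\<in>H +>\<^bsub>M\<^esub> x. H +>\<^bsub>M\<^esub> (r \<odot>\<^bsub>M\<^esub> y)) = H +>\<^bsub>M\<^esub> (r \<odot>\<^bsub>M\<^esub> x)" by blast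
    then show ?thesis by (simp add: quotient_module_def)
  qed
  have zero: "\<zero>\<^bsub>quotient_module M H\<^esub> = H +>\<^bsub>M\<^esub> \<zero>\<^bsub>M\<^esub>"
    using H.a_subset by (simp add: quotient_module_def a_coset_add_zero)
  have ag: "abelian_group (quotient_module M H)"
  proof (rule abelian_groupI)
    fix X assume "X \<in> carrier (quotient_module M H)"
    then obtain x where x: "x \<in> carrier M" "X = H +>\<^bsub>M\<^esub> x" by (auto simp: carr)
    then show "\<exists>y\<in>carrier (quotient_module M H). y \<oplus>\<^bsub>quotient_module M H\<^esub> X = \<zero>\<^bsub>quotient_module M H\<^esub>"
      by (intro bexI[of _ "H +>\<^bsub>M\<^esub> (\<ominus>\<^bsub>M\<^esub> x)"]) (auto simp: carr add zero M.l_neg)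
  qed (auto simp: carr add zero M.a_ac)
  show "module K (quotient_module M H)"
    by (rule moduleI[OF R.is_cring ag])
      (auto simp: carr add sm smult_l_distr smult_r_distr smult_assoc1)
  show "(\<lambda>x. H +>\<^bsub>M\<^esub> x) \<in> linear_maps K M (quotient_module M H)"
    by (rule linear_mapsI) (auto simp: carr add sm)
qed


lemma linear_mapsD:
  assumes "f \<in> linear_maps K M N"
  shows "x \<in> carrier M \<Longrightarrow> f x \<in> carrier N"
    "\<lbrakk>x \<in> carrier M; y \<in> carrier M\<rbrakk> \<Longrightarrow> f (x \<oplus>\<^bsub>M\<^esub> y) = f x \<oplus>\<^bsub>N\<^esub> f y"
    "\<lbrakk>r \<in> carrier K; x \<in> carrier M\<rbrakk> \<Longrightarrow> f (r \<odot>\<^bsub>M\<^esub> x) = r \<odot>\<^bsub>N\<^esub> f x"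
  using assms by (auto simp: linear_maps_def)

lemma linear_maps_zero:
  assumes "module K M" "module K N" "f \<in> linear_maps K M N"
  shows "f \<zero>\<^bsub>M\<^esub> = \<zero>\<^bsub>N\<^esub>"
proof -
  interpret M: module K M by fact
  interpret N: module K N by fact
  have "f (\<zero>\<^bsub>K\<^esub> \<odot>\<^bsub>M\<^esub> \<zero>\<^bsub>M\<^esub>) = \<zero>\<^bsub>K\<^esub> \<odot>\<^bsub>N\<^esub> f \<zero>\<^bsub>M\<^esub>"
    by (rule linear_mapsD(3)[OF assms(3)]) auto
  then show ?thesis using linear_mapsD(1)[OF assms(3), of "\<zero>\<^bsub>M\<^esub>"] by simp
qed

lemma linear_maps_minus:
  assumes "module K M" "module K N" "f \<in> linear_maps K M N" "x \<in> carrier M" "y \<in> carrier M"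
  shows "f (x \<ominus>\<^bsub>M\<^esub> y) = f x \<ominus>\<^bsub>N\<^esub> f y"
proof -
  interpret M: module K M by fact
  interpret N: module K N by fact
  have "f (x \<ominus>\<^bsub>M\<^esub> y) \<oplus>\<^bsub>N\<^esub> f y = f x"
    using assms linear_mapsD[OF assms(3)]
    by (metis M.minus_closed M.minus_eq M.a_inv_closed M.a_assoc M.l_neg M.r_zero)
  then show ?thesis using assms linear_mapsD(1)[OF assms(3)]
    by (metis M.minus_closed N.a_inv_closed N.a_assoc N.minus_eq N.r_neg N.r_zero)
qed

lemma free_ext:
  assumes "module K P" and b: "\<And>x y. (x, y) \<in> S \<Longrightarrow> b x y \<in> carrier P"
  shows "free_ext K P b \<in> linear_maps K (free_module K S) P"
    and "(x, y) \<in> S \<Longrightarrow> free_ext K P b (free_gen K (x, y)) = b x y"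
proof -
  interpret module K P by fact
  have sup: "free_ext K P b f = (\<Oplus>\<^bsub>P\<^esub>z\<in>A. f z \<odot>\<^bsub>P\<^esub> b (fst z) (snd z))"
    if "f \<in> carrier (free_module K S)" "finite A" "A \<subseteq> S" "{z. f z \<noteq> \<zero>\<^bsub>K\<^esub>} \<subseteq> A" for f A
    unfolding free_ext_def
    by (rule M.add.finprod_mono_neutral_cong_left) (use that b in \<open>auto simp: free_module_def subset_iff\<close>)
  have fin: "finite {z. f z \<noteq> \<zero>\<^bsub>K\<^esub>}" "{z. f z \<noteq> \<zero>\<^bsub>K\<^esub>} \<subseteq> S" "f z \<in> carrier K" if "f \<in> carrier (free_module K S)" for f z
    using that by (cases z; auto simp: free_module_def)+
  interpret F: module K "free_module K S" by (rule free_module_module) (rule R.is_cring)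
  show "free_ext K P b \<in> linear_maps K (free_module K S) P"
  proof (rule linear_mapsI)
    fix f assume f: "f \<in> carrier (free_module K S)"
    show "free_ext K P b f \<in> carrier P"
      unfolding free_ext_def using fin[OF f] b
      by (intro M.finsum_closed) (auto simp: subset_iff)
    { fix g assume g: "g \<in> carrier (free_module K S)"
      let ?A = "{z. f z \<noteq> \<zero>\<^bsub>K\<^esub>} \<union> {z. g z \<noteq> \<zero>\<^bsub>K\<^esub>}"
      have A: "finite ?A" "?A \<subseteq> S" using fin f g by auto
      have bA: "b (fst z) (snd z) \<in> carrier P" if "z \<in> ?A" for z using that A(2) b[of "fst z" "snd z"] by (auto simp only: prod.collapse)
      have "{z. (f \<oplus>\<^bsub>free_module K S\<^esub> g) z \<noteq> \<zero>\<^bsub>K\<^esub>} \<subseteq> ?A" by (auto simp: free_module_def)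
      then have "free_ext K P b (f \<oplus>\<^bsub>free_module K S\<^esub> g) =
        (\<Oplus>\<^bsub>P\<^esub>z\<in>?A. (f \<oplus>\<^bsub>free_module K S\<^esub> g) z \<odot>\<^bsub>P\<^esub> b (fst z) (snd z))"
        using A f g by (intro sup) auto
      also have "\<dots> = (\<Oplus>\<^bsub>P\<^esub>z\<in>?A. f z \<odot>\<^bsub>P\<^esub> b (fst z) (snd z) \<oplus>\<^bsub>P\<^esub> g z \<odot>\<^bsub>P\<^esub> b (fst z) (snd z))"
        using fin(3) f g bA by (intro M.finsum_cong') (auto simp: free_module_def smult_l_distr)
      also have "\<dots> = (\<Oplus>\<^bsub>P\<^esub>z\<in>?A. f z \<odot>\<^bsub>P\<^esub> b (fst z) (snd z)) \<oplus>\<^bsub>P\<^esub> (\<Oplus>\<^bsub>P\<^esub>z\<in>?A. g z \<odot>\<^bsub>P\<^esub> b (fst z) (snd z))"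
        using fin(3) f g bA by (intro M.finsum_addf) blast+
      also have "\<dots> = free_ext K P b f \<oplus>\<^bsub>P\<^esub> free_ext K P b g"
        using sup[OF f A] sup[OF g A] by simp
      finally show "free_ext K P b (f \<oplus>\<^bsub>free_module K S\<^esub> g) = free_ext K P b f \<oplus>\<^bsub>P\<^esub> free_ext K P b g" . }
    fix r assume r: "r \<in> carrier K"
    let ?A = "{z. f z \<noteq> \<zero>\<^bsub>K\<^esub>}"
    have A: "finite ?A" "?A \<subseteq> S" using fin f by auto
    have bA: "b (fst z) (snd z) \<in> carrier P" if "z \<in> ?A" for z using that A(2) b[of "fst z" "snd z"] by (auto simp only: prod.collapse)
    have "{z. (r \<odot>\<^bsub>free_module K S\<^esub> f) z \<noteq> \<zero>\<^bsub>K\<^esub>} \<subseteq> ?A" using r by (auto simp: free_module_def)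
    then have "free_ext K P b (r \<odot>\<^bsub>free_module K S\<^esub> f) =
        (\<Oplus>\<^bsub>P\<^esub>z\<in>?A. (r \<odot>\<^bsub>free_module K S\<^esub> f) z \<odot>\<^bsub>P\<^esub> b (fst z) (snd z))"
      using A f r by (intro sup) auto
    also have "\<dots> = (\<Oplus>\<^bsub>P\<^esub>z\<in>?A. r \<odot>\<^bsub>P\<^esub> (f z \<odot>\<^bsub>P\<^esub> b (fst z) (snd z)))"
      using fin(3) f r bA by (intro M.finsum_cong') (auto simp: free_module_def smult_assoc1)
    also have "\<dots> = r \<odot>\<^bsub>P\<^esub> free_ext K P b f"
      unfolding free_ext_def using A fin(3) f r bA by (intro finsum_smult_ldistr[symmetric]) blast+
    finally show "free_ext K P b (r \<odot>\<^bsub>free_module K S\<^esub> f) = r \<odot>\<^bsub>P\<^esub> free_ext K P b f" .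
  qed
  assume xy: "(x, y) \<in> S"
  have g: "free_gen K (x, y) \<in> carrier (free_module K S)"
    using xy by (auto simp: free_module_def free_gen_def)
  show "free_ext K P b (free_gen K (x, y)) = b x y"
  proof -
    have "{z. free_gen K (x, y) z \<noteq> \<zero>\<^bsub>K\<^esub>} \<subseteq> {(x, y)}" by (auto simp: free_gen_def)
    then show ?thesis using sup[OF g, of "{(x, y)}"] b[OF xy] xy by (simp add: free_gen_def)
  qed
qed

lemma tensor_relations_subset:
  assumes "module K M" "module K N"
  shows "tensor_relations K M N \<subseteq> carrier (free_module K (carrier M \<times> carrier N))"
proof -
  interpret M: module K M by fact
  interpret N: module K N by fact
  interpret F: module K "free_module K (carrier M \<times> carrier N)" by (rule free_module_module) (rule M.R.is_cring)
  have g: "free_gen K (x, y) \<in> carrier (free_module K (carrier M \<times> carrier N))" if "x \<in> carrier M" "y \<in> carrier N" for x y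
    using that by (auto simp: free_module_def free_gen_def)
  show ?thesis by (auto simp: tensor_relations_def Let_def g)
qed

lemma tensor_module_module:
  assumes "module K M" "module K N"
  shows "module K (tensor_module K M N)"
    "submodule (tensor_kernel K M N) K (free_module K (carrier M \<times> carrier N))"
proof -
  have F: "module K (free_module K (carrier M \<times> carrier N))" by (rule free_module_module[OF module.axioms(1)[OF assms(1)]])
  show *: "submodule (tensor_kernel K M N) K (free_module K (carrier M \<times> carrier N))"
    unfolding tensor_kernel_def by (rule generated_submodule[OF F tensor_relations_subset[OF assms]])
  show "module K (tensor_module K M N)" unfolding tensor_module_def by (rule quotient_module[OF F *])
qed

lemma tensor_lift_coset:
  assumes M: "module K M" and N: "module K N" and P: "module K P" and b: "b \<in> bilinear_maps K M N P"
    and f: "f \<in> carrier (free_module K (carrier M \<times> carrier N))"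
  shows "tensor_lift K P b (tensor_kernel K M N +>\<^bsub>free_module K (carrier M \<times> carrier N)\<^esub> f) = free_ext K P b f"
proof -
  let ?F = "free_module K (carrier M \<times> carrier N)"
  interpret M: module K M by fact
  interpret N: module K N by fact
  interpret P: module K P by fact
  interpret F: module K ?F by (rule free_module_module) (rule M.R.is_cring)
  have bc: "b x y \<in> carrier P" if "(x, y) \<in> carrier M \<times> carrier N" for x y
    using b that by (auto simp: bilinear_maps_def linear_maps_def)
  have lin: "free_ext K P b \<in> linear_maps K ?F P" by (rule free_ext(1)[OF P]) (erule bc)
  have gen: "free_ext K P b (free_gen K (x, y)) = b x y" if "x \<in> carrier M" "y \<in> carrier N" for x y
    by (rule free_ext(2)[OF P, where S = "carrier M \<times> carrier N"]) (use that in \<open>auto intro: bc\<close>)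
  have g: "free_gen K (x, y) \<in> carrier ?F" if "x \<in> carrier M" "y \<in> carrier N" for x y
    using that by (auto simp: free_module_def free_gen_def)
  note bl = linear_mapsD[OF bspec[OF conjunct1[OF b[unfolded bilinear_maps_def mem_Collect_eq]]]]
    linear_mapsD[OF bspec[OF conjunct2[OF b[unfolded bilinear_maps_def mem_Collect_eq]]]]
  let ?H = "{h \<in> carrier ?F. free_ext K P b h = \<zero>\<^bsub>P\<^esub>}"
  have "submodule ?H K ?F"
  proof (rule F.submoduleI)
    fix a assume a: "a \<in> ?H"
    have "free_ext K P b (\<ominus>\<^bsub>?F\<^esub> a) = \<zero>\<^bsub>P\<^esub>"
      using a linear_maps_minus[OF F.module_axioms P lin, of "\<zero>\<^bsub>?F\<^esub>" a] linear_maps_zero[OF F.module_axioms P lin]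
      by (auto simp: F.minus_eq P.minus_eq)
    then show "\<ominus>\<^bsub>?F\<^esub> a \<in> ?H" using a by auto
  qed (auto simp: linear_mapsD[OF lin] linear_maps_zero[OF F.module_axioms P lin])
  moreover have "tensor_relations K M N \<subseteq> ?H"
    using tensor_relations_subset[OF M N]
    by (auto simp: tensor_relations_def Let_def linear_maps_minus[OF F.module_axioms P lin] g gen linear_mapsD[OF lin] bl
       P.minus_eq P.r_neg)
  ultimately have ker: "tensor_kernel K M N \<subseteq> ?H"
    by (auto simp: tensor_kernel_def generated_submodule_def)
  have zk: "\<zero>\<^bsub>?F\<^esub> \<in> tensor_kernel K M N"
    using subgroup.one_closed[OF submodule.axioms(1)[OF tensor_module_module(2)[OF M N]]] by simp
  have "free_ext K P b h = free_ext K P b f" if h: "h \<in> tensor_kernel K M N +>\<^bsub>?F\<^esub> f" for h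
  proof -
    obtain k where k: "k \<in> tensor_kernel K M N" "h = k \<oplus>\<^bsub>?F\<^esub> f" using h by (auto simp: a_r_coset_def r_coset_def)
    then have "k \<in> carrier ?F" "free_ext K P b k = \<zero>\<^bsub>P\<^esub>" using ker by auto
    then show ?thesis using k f by (simp add: linear_mapsD[OF lin])
  qed
  moreover have "f \<in> tensor_kernel K M N +>\<^bsub>?F\<^esub> f"
    using zk f by (force simp: a_r_coset_def r_coset_def)
  ultimately have "free_ext K P b ` (tensor_kernel K M N +>\<^bsub>?F\<^esub> f) = {free_ext K P b f}" by blast 
  then show ?thesis by (simp add: tensor_lift_def)
qed

lemma carrier_tensor:
  "carrier (tensor_module K M N) =
    (\<lambda>f. tensor_kernel K M N +>\<^bsub>free_module K (carrier M \<times> carrier N)\<^esub> f) ` carrier (free_module K (carrier M \<times> carrier N))"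
  by (auto simp: tensor_module_def quotient_module_def A_RCOSETS_def RCOSETS_def a_r_coset_def)

lemma tensor_lift:
  assumes M: "module K M" and N: "module K N" and P: "module K P" and b: "b \<in> bilinear_maps K M N P"
  shows "tensor_lift K P b \<in> linear_maps K (tensor_module K M N) P"
    "\<lbrakk>x \<in> carrier M; y \<in> carrier N\<rbrakk> \<Longrightarrow> tensor_lift K P b (pure_tensor K M N x y) = b x y"
proof -
  let ?F = "free_module K (carrier M \<times> carrier N)"
  interpret M: module K M by fact
  interpret F: module K ?F by (rule free_module_module) (rule M.R.is_cring)
  have bc: "b x y \<in> carrier P" if "(x, y) \<in> carrier M \<times> carrier N" for x y
    using b that by (auto simp: bilinear_maps_def linear_maps_def)
  have "free_ext K P b \<in> linear_maps K ?F P" by (rule free_ext(1)[OF P]) (erule bc)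
  note lin = linear_mapsD[OF this]
  note Q = linear_mapsD[OF quotient_module(2)[OF F.module_axioms tensor_module_module(2)[OF M N], folded tensor_module_def]]
  note co = tensor_lift_coset[OF M N P b]
  show "tensor_lift K P b \<in> linear_maps K (tensor_module K M N) P"
    by (rule linear_mapsI) (auto simp: carrier_tensor Q(2,3)[symmetric] co lin)
  assume "x \<in> carrier M" "y \<in> carrier N"
  then show "tensor_lift K P b (pure_tensor K M N x y) = b x y"
    unfolding pure_tensor_def
    by (subst co) (auto simp: free_module_def free_gen_def intro!: free_ext(2)[OF P, where S = "carrier M \<times> carrier N", unfolded free_gen_def] bc)
qed


section \<open>Lie algebras\<close>

record ('k, 'g) lie_structure = "('k, 'g) module" +
  bracket :: "'g \<Rightarrow> 'g \<Rightarrow> 'g"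

locale lie_algebra = field K + module K L for K (structure) and L :: "('k, 'g, 's) lie_structure_scheme" +
  assumes bracket_bilinear: "bracket L \<in> bilinear_maps K L L L"
    and bracket_self: "x \<in> carrier L \<Longrightarrow> bracket L x x = \<zero>\<^bsub>L\<^esub>"
    and jacobi: "\<lbrakk>x \<in> carrier L; y \<in> carrier L; z \<in> carrier L\<rbrakk> \<Longrightarrow>
       bracket L (bracket L x y) z \<oplus>\<^bsub>L\<^esub> bracket L (bracket L y z) x \<oplus>\<^bsub>L\<^esub> bracket L (bracket L z x) y
         = \<zero>\<^bsub>L\<^esub>"

text \<open>\<open>\<gg>' = k\<gamma> \<oplus> \<gg>\<close>, where \<open>a\<gamma> + x\<close> is the pair \<open>(a, x)\<close>.\<close>

definition gamma_extension ::
  "('k, 'r) ring_scheme \<Rightarrow> ('k, 'g, 's) lie_structure_scheme \<Rightarrow> ('k, 'k \<times> 'g) lie_structure"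
  where "gamma_extension K L = module.extend (direct_sum_module (scalar_module K) L)
     \<lparr>bracket = (\<lambda>(a, x) (b, y). (\<zero>\<^bsub>K\<^esub>, bracket L x y))\<rparr>"

lemma gamma_extension_lie:
  assumes "lie_algebra K L" shows "lie_algebra K (gamma_extension K L)"
proof -
  interpret lie_algebra K L by fact
  note bl = linear_mapsD[OF bspec[OF conjunct1[OF bracket_bilinear[unfolded bilinear_maps_def mem_Collect_eq]]]]
    linear_mapsD[OF bspec[OF conjunct2[OF bracket_bilinear[unfolded bilinear_maps_def mem_Collect_eq]]]]
  have K: "abelian_monoid K" by (rule abelian_group.axioms(1)[OF is_abelian_group])
  have ag: "abelian_group (gamma_extension K L)"
  proof (rule abelian_groupI)
    fix x assume "x \<in> carrier (gamma_extension K L)"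
    then show "\<exists>y\<in>carrier (gamma_extension K L). y \<oplus>\<^bsub>gamma_extension K L\<^esub> x = \<zero>\<^bsub>gamma_extension K L\<^esub>"
      by (intro bexI[of _ "(\<ominus>\<^bsub>K\<^esub> fst x, \<ominus>\<^bsub>L\<^esub> snd x)"])
        (auto simp: gamma_extension_def module.defs direct_sum_module_def scalar_module_def M.l_neg abelian_group.l_neg[OF is_abelian_group])
  qed (auto simp: gamma_extension_def module.defs direct_sum_module_def scalar_module_def M.a_ac abelian_monoid.a_assoc[OF K] abelian_monoid.a_comm[OF K]
      abelian_monoid.a_lcomm[OF K])
  have "module K (gamma_extension K L)"
    by (rule moduleI[OF is_cring ag])
     (auto simp: gamma_extension_def module.defs direct_sum_module_def scalar_module_def smult_l_distr smult_r_distr smult_assoc1 l_distr r_distr m_assoc)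
  then show ?thesis
    by (auto intro!: lie_algebra.intro lie_algebra_axioms.intro field_axioms simp: bilinear_maps_def linear_maps_def gamma_extension_def module.defs direct_sum_module_def scalar_module_def bl bracket_self jacobi)
qed

definition gamma_form ::
  "('k, 'g, 's) lie_structure_scheme \<Rightarrow> ('g \<Rightarrow> 'g \<Rightarrow> 'k) \<Rightarrow> 'k \<times> 'g \<Rightarrow> 'k \<times> 'g \<Rightarrow> 'k \<times> 'g"
  where "gamma_form L \<psi> = (\<lambda>(a, x) (b, y). (\<psi> x y, \<zero>\<^bsub>L\<^esub>))"


section \<open>The coalgebra \<open>k \<oplus> \<gg>\<close> of a Lie algebra and its shelf cocycles\<close>

text \<open>The element \<open>a + u\<close> of \<open>N = k \<oplus> \<gg>\<close> is the pair \<open>(a, u)\<close>.\<close>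

definition shelf_module ::
  "('k, 'r) ring_scheme \<Rightarrow> ('k, 'g, 's) lie_structure_scheme \<Rightarrow> ('k, 'k \<times> 'g) module"
  where "shelf_module K L = direct_sum_module (scalar_module K) L"

definition shelf_comult ::
  "('k, 'r) ring_scheme \<Rightarrow> ('k, 'g, 's) lie_structure_scheme \<Rightarrow>
   'k \<times> 'g \<Rightarrow> (('k \<times> 'g) \<times> ('k \<times> 'g) \<Rightarrow> 'k) set"
  where "shelf_comult K L = (\<lambda>(a, u).
     let N = shelf_module K L; NN = tensor_module K N N; t = pure_tensor K N N;
         e = (\<one>\<^bsub>K\<^esub>, \<zero>\<^bsub>L\<^esub>); u' = (\<zero>\<^bsub>K\<^esub>, u)
     in a \<odot>\<^bsub>NN\<^esub> t e e \<oplus>\<^bsub>NN\<^esub> (t u' e \<oplus>\<^bsub>NN\<^esub> t e u'))"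

text \<open>The counit is part of the coalgebra structure but does not occur in the differentials.\<close>

definition shelf_counit :: "'k \<times> 'g \<Rightarrow> 'k"
  where "shelf_counit = (\<lambda>(a, u). a)"

definition shelf_op ::
  "('k, 'r) ring_scheme \<Rightarrow> ('k, 'g, 's) lie_structure_scheme \<Rightarrow>
   (('k \<times> 'g) \<times> ('k \<times> 'g) \<Rightarrow> 'k) set \<Rightarrow> 'k \<times> 'g"
  where "shelf_op K L = tensor_lift K (shelf_module K L)
     (\<lambda>(a, u) (b, v). (a \<otimes>\<^bsub>K\<^esub> b, b \<odot>\<^bsub>L\<^esub> u \<oplus>\<^bsub>L\<^esub> bracket L u v))"

definition shelf_hat ::
  "('k, 'r) ring_scheme \<Rightarrow> ('k, 'g, 's) lie_structure_scheme \<Rightarrow> ('g \<Rightarrow> 'g \<Rightarrow> 'g) \<Rightarrow>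
   (('k \<times> 'g) \<times> ('k \<times> 'g) \<Rightarrow> 'k) set \<Rightarrow> 'k \<times> 'g"
  where "shelf_hat K L \<phi> = tensor_lift K (shelf_module K L) (\<lambda>(a, u) (b, v). (\<zero>\<^bsub>K\<^esub>, \<phi> u v))"

text \<open>
  The differentials \<open>d\<^bsup>2,1\<^esup>(\<eta>, 0)\<close> on \<open>(N \<otimes> N) \<otimes> N\<close> and \<open>d\<^bsup>2,2\<^esup>(\<eta>, 0)\<close> on \<open>N \<otimes> N\<close>.
\<close>

definition shelf_d21 ::
  "('k, 'r) ring_scheme \<Rightarrow> ('k, 'g, 's) lie_structure_scheme \<Rightarrow>
   ((('k \<times> 'g) \<times> ('k \<times> 'g) \<Rightarrow> 'k) set \<Rightarrow> 'k \<times> 'g) \<Rightarrow>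
   ((('k \<times> 'g) \<times> ('k \<times> 'g) \<Rightarrow> 'k) set \<times> ('k \<times> 'g) \<Rightarrow> 'k) set \<Rightarrow> 'k \<times> 'g"
  where "shelf_d21 K L \<eta> t =
     (let N = shelf_module K L; NN = tensor_module K N N; q = shelf_op K L;
          tm = tensor_map K N N;
          s = tensor_flip2 K N (tensor_map K NN NN (tensor_map K N N id id) (shelf_comult K L) t)
      in (q (tensor_map K N N \<eta> id t) \<oplus>\<^bsub>N\<^esub> \<eta> (tensor_map K N N q id t)) \<ominus>\<^bsub>N\<^esub>
         (\<eta> (tm q q s) \<oplus>\<^bsub>N\<^esub> q (tm \<eta> q s) \<oplus>\<^bsub>N\<^esub> q (tm q \<eta> s)))"

definition shelf_d22 ::
  "('k, 'r) ring_scheme \<Rightarrow> ('k, 'g, 's) lie_structure_scheme \<Rightarrow>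
   ((('k \<times> 'g) \<times> ('k \<times> 'g) \<Rightarrow> 'k) set \<Rightarrow> 'k \<times> 'g) \<Rightarrow>
   (('k \<times> 'g) \<times> ('k \<times> 'g) \<Rightarrow> 'k) set \<Rightarrow> (('k \<times> 'g) \<times> ('k \<times> 'g) \<Rightarrow> 'k) set"
  where "shelf_d22 K L \<eta> t =
     (let N = shelf_module K L; NN = tensor_module K N N; q = shelf_op K L;
          tm = tensor_map K N N; \<Delta> = shelf_comult K L;
          s = tensor_flip2 K N (tensor_map K NN NN \<Delta> \<Delta> t)
      in \<Delta> (\<eta> t) \<ominus>\<^bsub>NN\<^esub> (tm \<eta> q s \<oplus>\<^bsub>NN\<^esub> tm q \<eta> s))"

text \<open>The 2-cochain \<open>(\<eta>, 0)\<close>, with \<open>\<eta>\<close> a linear map \<open>N \<otimes> N \<rightarrow> N\<close>, is a cocycle.\<close>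

definition shelf_2_cocycle ::
  "('k, 'r) ring_scheme \<Rightarrow> ('k, 'g, 's) lie_structure_scheme \<Rightarrow>
   ((('k \<times> 'g) \<times> ('k \<times> 'g) \<Rightarrow> 'k) set \<Rightarrow> 'k \<times> 'g) \<Rightarrow> bool"
  where "shelf_2_cocycle K L \<eta> \<longleftrightarrow>
     (let N = shelf_module K L; NN = tensor_module K N N in
       \<eta> \<in> linear_maps K NN N \<and>
       (\<forall>t\<in>carrier (tensor_module K NN N). shelf_d21 K L \<eta> t = \<zero>\<^bsub>N\<^esub>) \<and>
       (\<forall>t\<in>carrier NN. shelf_d22 K L \<eta> t = \<zero>\<^bsub>NN\<^esub>))"

end

theory Submission
  imports Defs
begin

text \<open>
  Both differentials are linear in their argument, and pure tensors span, so it suffices to evaluate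
  them on elements \<open>(x \<otimes> y) \<otimes> z\<close> and \<open>x \<otimes> y\<close>.  That every map in sight is linear and does what it
  should to pure tensors comes from the universal property (lemmas \<open>pure_tensor_bilinear\<close>,
  \<open>linear_maps_eq_on_tensor\<close>, \<open>tensor_map\<close>, \<open>tensor_flip2\<close>).

  The evaluation is done for an arbitrary Lie algebra \<open>\<hh>\<close> and an arbitrary bilinear
  \<open>\<phi> : \<hh> \<times> \<hh> \<rightarrow> \<hh>\<close>, with \<open>\<eta>((a + u) \<otimes> (b + v)) = \<phi>(u, v)\<close>.  Values of \<open>\<eta>\<close> are primitive and \<open>\<eta>\<close> vanishes
  when one argument is \<open>1\<close>; as \<open>q(1 \<otimes> 1) = 1\<close>, this alone makes \<open>\<eta>\<close> an infinitesimal coderivation along \<open>q\<close>, so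
  \<open>d\<^bsup>2,2\<^esup>\<close> vanishes (\<open>shelf_d22_pure\<close>).  Self-distributivity of \<open>q\<close> restricted to primitive elements is the
  Jacobi identity, in the form that right brackets are derivations, and \<open>d\<^bsup>2,1\<^esup>\<close> is its linearisation: on
  pure tensors the scalar parts cancel and it becomes (\<open>shelf_d21_pure\<close>)
  \<open>[\<phi>(u, v), w] + \<phi>([u, v], w) - \<phi>([u, w], v) - \<phi>(u, [v, w]) - [\<phi>(u, w), v] - [u, \<phi>(v, w)]\<close>.
  Hence \<open>\<phi>\<close> gives a shelf cocycle as soon as this expression vanishes (\<open>shelf_hat_2_cocycle\<close>); for
  alternating \<open>\<phi>\<close> that is the condition for a Lie 2-cocycle with adjoint coefficients.

  A scalar cocycle \<open>\<psi>\<close> becomes such an adjoint cocycle on \<open>\<gg>' = k\<gamma> \<oplus> \<gg>\<close>: its values \<open>\<psi>(x, y) \<gamma>\<close> are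
  central, which kills the three brackets above, and they ignore \<open>\<gamma>\<close>-components, so the other three
  terms are the cocycle condition for \<open>\<psi>\<close>, rewritten by skew-symmetry.
\<close>


section \<open>Linear and bilinear maps\<close>

lemma bilinear_mapsI:
  assumes "\<And>x y. \<lbrakk>x \<in> carrier M; y \<in> carrier N\<rbrakk> \<Longrightarrow> b x y \<in> carrier P"
    and "\<And>x x' y. \<lbrakk>x \<in> carrier M; x' \<in> carrier M; y \<in> carrier N\<rbrakk> \<Longrightarrow> b (x \<oplus>\<^bsub>M\<^esub> x') y = b x y \<oplus>\<^bsub>P\<^esub> b x' y"
    and "\<And>x y y'. \<lbrakk>x \<in> carrier M; y \<in> carrier N; y' \<in> carrier N\<rbrakk> \<Longrightarrow> b x (y \<oplus>\<^bsub>N\<^esub> y') = b x y \<oplus>\<^bsub>P\<^esub> b x y'"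
    and "\<And>r x y. \<lbrakk>r \<in> carrier K; x \<in> carrier M; y \<in> carrier N\<rbrakk> \<Longrightarrow> b (r \<odot>\<^bsub>M\<^esub> x) y = r \<odot>\<^bsub>P\<^esub> b x y"
    and "\<And>r x y. \<lbrakk>r \<in> carrier K; x \<in> carrier M; y \<in> carrier N\<rbrakk> \<Longrightarrow> b x (r \<odot>\<^bsub>N\<^esub> y) = r \<odot>\<^bsub>P\<^esub> b x y"
  shows "b \<in> bilinear_maps K M N P"
  using assms by (auto simp: bilinear_maps_def linear_maps_def)

lemma bilinear_mapsD:
  assumes "b \<in> bilinear_maps K M N P"
  shows "\<lbrakk>x \<in> carrier M; y \<in> carrier N\<rbrakk> \<Longrightarrow> b x y \<in> carrier P"
    "\<lbrakk>x \<in> carrier M; x' \<in> carrier M; y \<in> carrier N\<rbrakk> \<Longrightarrow> b (x \<oplus>\<^bsub>M\<^esub> x') y = b x y \<oplus>\<^bsub>P\<^esub> b x' y"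
    "\<lbrakk>x \<in> carrier M; y \<in> carrier N; y' \<in> carrier N\<rbrakk> \<Longrightarrow> b x (y \<oplus>\<^bsub>N\<^esub> y') = b x y \<oplus>\<^bsub>P\<^esub> b x y'"
    "\<lbrakk>r \<in> carrier K; x \<in> carrier M; y \<in> carrier N\<rbrakk> \<Longrightarrow> b (r \<odot>\<^bsub>M\<^esub> x) y = r \<odot>\<^bsub>P\<^esub> b x y"
    "\<lbrakk>r \<in> carrier K; x \<in> carrier M; y \<in> carrier N\<rbrakk> \<Longrightarrow> b x (r \<odot>\<^bsub>N\<^esub> y) = r \<odot>\<^bsub>P\<^esub> b x y"
  using assms by (auto simp: bilinear_maps_def linear_maps_def)

lemma bilinear_maps_linear:
  assumes "b \<in> bilinear_maps K M N P"
  shows "x \<in> carrier M \<Longrightarrow> b x \<in> linear_maps K N P"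
    and "y \<in> carrier N \<Longrightarrow> (\<lambda>x. b x y) \<in> linear_maps K M P"
  using assms by (auto simp: bilinear_maps_def)

lemma bilinear_maps_zero:
  assumes "module K M" "module K N" "module K P" "b \<in> bilinear_maps K M N P"
  shows "y \<in> carrier N \<Longrightarrow> b \<zero>\<^bsub>M\<^esub> y = \<zero>\<^bsub>P\<^esub>" and "x \<in> carrier M \<Longrightarrow> b x \<zero>\<^bsub>N\<^esub> = \<zero>\<^bsub>P\<^esub>"
  using linear_maps_zero[OF assms(1,3) bilinear_maps_linear(2)[OF assms(4)]]
    linear_maps_zero[OF assms(2,3) bilinear_maps_linear(1)[OF assms(4)]] by auto

lemma linear_maps_comp:
  assumes "g \<in> linear_maps K N P" "f \<in> linear_maps K M N"
  shows "(\<lambda>x. g (f x)) \<in> linear_maps K M P"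
  by (rule linear_mapsI) (simp_all add: linear_mapsD[OF assms(1)] linear_mapsD[OF assms(2)])

lemma linear_maps_id: "id \<in> linear_maps K M M"
  by (rule linear_mapsI) simp_all

lemma linear_maps_add:
  assumes "module K N" "f \<in> linear_maps K M N" "g \<in> linear_maps K M N"
  shows "(\<lambda>x. f x \<oplus>\<^bsub>N\<^esub> g x) \<in> linear_maps K M N"
proof -
  interpret N: module K N by fact
  show ?thesis
    by (rule linear_mapsI)
      (simp_all add: linear_mapsD[OF assms(2)] linear_mapsD[OF assms(3)] N.smult_r_distr N.a_ac)
qed

lemma linear_maps_diff:
  assumes "module K N" "f \<in> linear_maps K M N" "g \<in> linear_maps K M N"
  shows "(\<lambda>x. f x \<ominus>\<^bsub>N\<^esub> g x) \<in> linear_maps K M N"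
proof -
  interpret N: module K N by fact
  show ?thesis
    by (rule linear_mapsI)
      (simp_all add: linear_mapsD[OF assms(2)] linear_mapsD[OF assms(3)] N.smult_r_distr
        N.smult_r_minus N.minus_eq N.minus_add N.a_ac)
qed

lemma linear_maps_const_zero:
  assumes "module K N" shows "(\<lambda>x. \<zero>\<^bsub>N\<^esub>) \<in> linear_maps K M N"
proof -
  interpret N: module K N by fact
  show ?thesis by (rule linear_mapsI) simp_all
qed

lemma (in abelian_group) minus_eq_zero_iff:
  assumes "x \<in> carrier G" "y \<in> carrier G"
  shows "x \<ominus> y = \<zero> \<longleftrightarrow> x = y"
  using assms minus_equality[of x "\<ominus> y"] by (auto simp: minus_eq r_neg)

lemma (in abelian_group) add_diff_cancel_left:
  assumes "x \<in> carrier G" "s \<in> carrier G" "t \<in> carrier G"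
  shows "(x \<oplus> s) \<ominus> (x \<oplus> t) = s \<ominus> t"
proof -
  have "(x \<oplus> s) \<ominus> (x \<oplus> t) = (x \<oplus> \<ominus> x) \<oplus> (s \<oplus> \<ominus> t)"
    using assms by (simp only: minus_eq minus_add a_ac a_closed a_inv_closed)
  then show ?thesis using assms by (simp add: minus_eq r_neg)
qed


section \<open>Pure tensors are bilinear and span the tensor product\<close>

lemma free_module_spanned_by_gens:
  assumes K: "cring K" and H: "submodule H K (free_module K S)"
    and gens: "\<And>s. s \<in> S \<Longrightarrow> free_gen K s \<in> H"
  shows "carrier (free_module K S) \<subseteq> H"
proof
  let ?F = "free_module K S"
  interpret K: cring K by fact
  interpret F: module K ?F by (rule free_module_module[OF K])
  note HE = F.submoduleE[OF H]
  fix f assume "f \<in> carrier ?F"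
  then show "f \<in> H"
  proof (induction "card {x. f x \<noteq> \<zero>\<^bsub>K\<^esub>}" arbitrary: f)
    case 0
    then have "f = \<zero>\<^bsub>?F\<^esub>" by (auto simp: free_module_def)
    then show ?case using subgroup.one_closed[OF submodule.axioms(1)[OF H]] by simp
  next
    case (Suc n)
    then obtain s where s: "f s \<noteq> \<zero>\<^bsub>K\<^esub>"
      by (metis (mono_tags, lifting) card.empty empty_Collect_eq nat.distinct(1))
    have f: "f x \<in> carrier K" "s \<in> S" "finite {x. f x \<noteq> \<zero>\<^bsub>K\<^esub>}" for x
      using Suc.prems s by (auto simp: free_module_def)
    let ?g = "f(s := \<zero>\<^bsub>K\<^esub>)"
    have supp: "{x. ?g x \<noteq> \<zero>\<^bsub>K\<^esub>} = {x. f x \<noteq> \<zero>\<^bsub>K\<^esub>} - {s}" by auto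
    have "?g \<in> carrier ?F" using Suc.prems by (auto simp: free_module_def supp[simplified])
    moreover have "card {x. ?g x \<noteq> \<zero>\<^bsub>K\<^esub>} = n"
      using Suc.hyps(2) s f(3) unfolding supp by simp
    ultimately have "?g \<in> H" using Suc.hyps(1) by blast
    moreover have "f s \<odot>\<^bsub>?F\<^esub> free_gen K s \<in> H" using submodule.smult_closed[OF H] gens f by blast
    ultimately have "?g \<oplus>\<^bsub>?F\<^esub> f s \<odot>\<^bsub>?F\<^esub> free_gen K s \<in> H" using HE by blast
    moreover have "?g \<oplus>\<^bsub>?F\<^esub> f s \<odot>\<^bsub>?F\<^esub> free_gen K s = f"
      using f by (auto simp: free_module_def free_gen_def fun_eq_iff)
    ultimately show ?case by simp
  qed
qed

text \<open>
  The coset map from the free module is linear, and it kills the generating relations; each of these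
  is the difference of the two sides of one bilinearity law.
\<close>

lemma pure_tensor_bilinear:
  assumes M: "module K M" and N: "module K N"
  shows "pure_tensor K M N \<in> bilinear_maps K M N (tensor_module K M N)"
proof -
  let ?F = "free_module K (carrier M \<times> carrier N)"
  let ?T = "tensor_module K M N"
  let ?p = "\<lambda>f. tensor_kernel K M N +>\<^bsub>?F\<^esub> f"
  interpret M: module K M by fact
  interpret N: module K N by fact
  interpret F: module K ?F by (rule free_module_module) (rule M.R.is_cring)
  interpret T: module K ?T by (rule tensor_module_module(1)[OF M N])
  note sub = tensor_module_module(2)[OF M N]
  have lin: "?p \<in> linear_maps K ?F ?T"
    unfolding tensor_module_def by (rule quotient_module(2)[OF F.module_axioms sub])
  note L = linear_mapsD[OF lin]
  have g: "free_gen K (x, y) \<in> carrier ?F" if "x \<in> carrier M" "y \<in> carrier N" for x y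
    using that by (auto simp: free_module_def free_gen_def)
  have eqI: "?p f = ?p g" if "f \<ominus>\<^bsub>?F\<^esub> g \<in> tensor_relations K M N" "f \<in> carrier ?F" "g \<in> carrier ?F" for f g
  proof -
    have ker: "f \<ominus>\<^bsub>?F\<^esub> g \<in> tensor_kernel K M N"
      using that generated_submodule(2)[OF F.module_axioms tensor_relations_subset[OF M N]]
      by (auto simp: tensor_kernel_def)
    have "?p (f \<ominus>\<^bsub>?F\<^esub> g) = \<zero>\<^bsub>?T\<^esub>"
      using F.a_coset_join2[OF _ submodule.axioms(1)[OF sub] ker] that
      by (simp add: tensor_module_def quotient_module_def)
    then have "?p f \<ominus>\<^bsub>?T\<^esub> ?p g = \<zero>\<^bsub>?T\<^esub>"
      using linear_maps_minus[OF F.module_axioms T.module_axioms lin] that by simp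
    then show ?thesis using that L(1) T.minus_eq_zero_iff by simp
  qed
  show ?thesis
    unfolding pure_tensor_def
  proof (rule bilinear_mapsI, goal_cases)
    case 1 then show ?case by (intro L g)
  next
    case 2 then show ?case
      by (subst L(2)[symmetric], simp_all add: g) (intro eqI, auto simp: g tensor_relations_def Let_def)
  next
    case 3 then show ?case
      by (subst L(2)[symmetric], simp_all add: g) (intro eqI, auto simp: g tensor_relations_def Let_def)
  next
    case 4 then show ?case
      by (subst L(3)[symmetric], simp_all add: g) (intro eqI, auto simp: g tensor_relations_def Let_def)
  next
    case 5 then show ?case
      by (subst L(3)[symmetric], simp_all add: g) (intro eqI, auto simp: g tensor_relations_def Let_def)
  qed
qed

text \<open>
  Pure tensors span, because generators span the free module and the coset map is onto.  It is
  through this lemma that an identity of composites of structure maps becomes a computation with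
  elements: every such composite is linear, so pure tensors suffice.
\<close>

lemma linear_maps_eq_on_tensor:
  assumes M: "module K M" and N: "module K N" and P: "module K P"
    and f: "f \<in> linear_maps K (tensor_module K M N) P"
    and g: "g \<in> linear_maps K (tensor_module K M N) P"
    and eq: "\<And>x y. \<lbrakk>x \<in> carrier M; y \<in> carrier N\<rbrakk> \<Longrightarrow>
      f (pure_tensor K M N x y) = g (pure_tensor K M N x y)"
    and t: "t \<in> carrier (tensor_module K M N)"
  shows "f t = g t"
proof -
  let ?F = "free_module K (carrier M \<times> carrier N)"
  let ?p = "\<lambda>h. tensor_kernel K M N +>\<^bsub>?F\<^esub> h"
  interpret M: module K M by fact
  interpret P: module K P by fact
  interpret F: module K ?F by (rule free_module_module) (rule M.R.is_cring)
  have lin: "?p \<in> linear_maps K ?F (tensor_module K M N)"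
    unfolding tensor_module_def
    by (rule quotient_module(2)[OF F.module_axioms tensor_module_module(2)[OF M N]])
  have h: "(\<lambda>h. f (?p h) \<ominus>\<^bsub>P\<^esub> g (?p h)) \<in> linear_maps K ?F P"
    by (intro linear_maps_diff[OF P] linear_maps_comp[OF f lin] linear_maps_comp[OF g lin])
  note hD = linear_mapsD[OF h] linear_maps_zero[OF F.module_axioms P h]
    linear_maps_minus[OF F.module_axioms P h]
  let ?H = "{a \<in> carrier ?F. f (?p a) \<ominus>\<^bsub>P\<^esub> g (?p a) = \<zero>\<^bsub>P\<^esub>}"
  have "submodule ?H K ?F"
  proof (rule F.submoduleI)
    fix a assume a: "a \<in> ?H"
    then have "f (?p (\<zero>\<^bsub>?F\<^esub> \<ominus>\<^bsub>?F\<^esub> a)) \<ominus>\<^bsub>P\<^esub> g (?p (\<zero>\<^bsub>?F\<^esub> \<ominus>\<^bsub>?F\<^esub> a)) = \<zero>\<^bsub>P\<^esub>"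
      using hD(4) hD(5)[of "\<zero>\<^bsub>?F\<^esub>" a] by (simp add: P.minus_eq)
    then show "\<ominus>\<^bsub>?F\<^esub> a \<in> ?H" using a by (simp add: F.minus_eq)
  qed (use hD in auto)
  moreover have "free_gen K s \<in> ?H" if s: "s \<in> carrier M \<times> carrier N" for s
  proof -
    obtain x y where xy: "s = (x, y)" "x \<in> carrier M" "y \<in> carrier N" using s by auto
    have gen: "free_gen K s \<in> carrier ?F" using s by (auto simp: free_module_def free_gen_def)
    have "f (?p (free_gen K s)) = g (?p (free_gen K s))"
      using eq[OF xy(2,3)] by (simp add: pure_tensor_def xy)
    then show ?thesis
      using gen linear_mapsD(1)[OF linear_maps_comp[OF g lin] gen] by (simp add: P.minus_eq P.r_neg)
  qed
  ultimately have "carrier ?F \<subseteq> ?H"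
    by (rule free_module_spanned_by_gens[OF M.R.is_cring])
  moreover obtain a where a: "a \<in> carrier ?F" "t = ?p a" using t by (auto simp: carrier_tensor)
  ultimately show ?thesis
    using linear_mapsD(1)[OF linear_maps_comp[OF f lin]] linear_mapsD(1)[OF linear_maps_comp[OF g lin]] P.minus_eq_zero_iff
    by auto
qed

lemma linear_maps_eq_on_tensor3:
  assumes A: "module K A" and B: "module K B" and C: "module K C" and P: "module K P"
    and f: "f \<in> linear_maps K (tensor_module K (tensor_module K A B) C) P"
    and g: "g \<in> linear_maps K (tensor_module K (tensor_module K A B) C) P"
    and eq: "\<And>x y z. \<lbrakk>x \<in> carrier A; y \<in> carrier B; z \<in> carrier C\<rbrakk> \<Longrightarrow>
      f (pure_tensor K (tensor_module K A B) C (pure_tensor K A B x y) z)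
        = g (pure_tensor K (tensor_module K A B) C (pure_tensor K A B x y) z)"
    and t: "t \<in> carrier (tensor_module K (tensor_module K A B) C)"
  shows "f t = g t"
proof (rule linear_maps_eq_on_tensor[OF tensor_module_module(1)[OF A B] C P f g _ t])
  fix s z assume s: "s \<in> carrier (tensor_module K A B)" and z: "z \<in> carrier C"
  note lin = bilinear_maps_linear(2)[OF pure_tensor_bilinear[OF tensor_module_module(1)[OF A B] C] z]
  show "f (pure_tensor K (tensor_module K A B) C s z) = g (pure_tensor K (tensor_module K A B) C s z)"
    by (rule linear_maps_eq_on_tensor[OF A B P linear_maps_comp[OF f lin] linear_maps_comp[OF g lin] eq s])
      (use z in simp_all)
qed


section \<open>The structure maps on pure tensors\<close>

lemma tensor_map:
  assumes M: "module K M" and N: "module K N" and M': "module K M'" and N': "module K N'"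
    and f: "f \<in> linear_maps K M M'" and g: "g \<in> linear_maps K N N'"
  shows "tensor_map K M' N' f g \<in> linear_maps K (tensor_module K M N) (tensor_module K M' N')"
    "\<lbrakk>x \<in> carrier M; y \<in> carrier N\<rbrakk> \<Longrightarrow>
      tensor_map K M' N' f g (pure_tensor K M N x y) = pure_tensor K M' N' (f x) (g y)"
proof -
  have "(\<lambda>x y. pure_tensor K M' N' (f x) (g y)) \<in> bilinear_maps K M N (tensor_module K M' N')"
    by (rule bilinear_mapsI)
      (simp_all add: linear_mapsD[OF f] linear_mapsD[OF g] bilinear_mapsD[OF pure_tensor_bilinear[OF M' N']])
  note * = tensor_lift[OF M N tensor_module_module(1)[OF M' N'] this]
  show "tensor_map K M' N' f g \<in> linear_maps K (tensor_module K M N) (tensor_module K M' N')"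
    "\<lbrakk>x \<in> carrier M; y \<in> carrier N\<rbrakk> \<Longrightarrow>
      tensor_map K M' N' f g (pure_tensor K M N x y) = pure_tensor K M' N' (f x) (g y)"
    unfolding tensor_map_def by (fact *)+
qed

lemma tensor_map_id:
  assumes M: "module K M" and N: "module K N" and t: "t \<in> carrier (tensor_module K M N)"
  shows "tensor_map K M N id id t = t"
  using linear_maps_eq_on_tensor[OF M N tensor_module_module(1)[OF M N]
      tensor_map(1)[OF M N M N linear_maps_id linear_maps_id] linear_maps_id _ t]
    tensor_map(2)[OF M N M N linear_maps_id linear_maps_id]
  by simp

lemma tensor_flip:
  assumes M: "module K M" and N: "module K N"
  shows "tensor_flip K M N \<in> linear_maps K (tensor_module K M N) (tensor_module K N M)"
    "\<lbrakk>x \<in> carrier M; y \<in> carrier N\<rbrakk> \<Longrightarrow>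
      tensor_flip K M N (pure_tensor K M N x y) = pure_tensor K N M y x"
proof -
  have "(\<lambda>x y. pure_tensor K N M y x) \<in> bilinear_maps K M N (tensor_module K N M)"
    by (rule bilinear_mapsI) (simp_all add: bilinear_mapsD[OF pure_tensor_bilinear[OF N M]])
  note * = tensor_lift[OF M N tensor_module_module(1)[OF N M] this]
  show "tensor_flip K M N \<in> linear_maps K (tensor_module K M N) (tensor_module K N M)"
    "\<lbrakk>x \<in> carrier M; y \<in> carrier N\<rbrakk> \<Longrightarrow>
      tensor_flip K M N (pure_tensor K M N x y) = pure_tensor K N M y x"
    unfolding tensor_flip_def by (fact *)+
qed

text \<open>
  Currying: lifting a trilinear map in two of its arguments leaves a bilinear map, so it can be lifted
  again.  The two rebracketing isomorphisms are iterated lifts of this kind.  Bilinearity in the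
  lifted variable is the universal property; in the other variable it is an equality of two linear
  maps on a tensor product, to be checked on pure tensors.
\<close>

lemma tensor_lift_bilinear_left:
  assumes A: "module K A" and B: "module K B" and P: "module K P"
    and ab: "\<And>z. z \<in> carrier C \<Longrightarrow> (\<lambda>x y. b x y z) \<in> bilinear_maps K A B P"
    and c: "\<And>x y. \<lbrakk>x \<in> carrier A; y \<in> carrier B\<rbrakk> \<Longrightarrow> b x y \<in> linear_maps K C P"
    and C: "module K C"
  shows "(\<lambda>s z. tensor_lift K P (\<lambda>x y. b x y z) s) \<in> bilinear_maps K (tensor_module K A B) C P"
proof -
  interpret P: module K P by fact
  interpret C: module K C by fact
  let ?l = "\<lambda>z. tensor_lift K P (\<lambda>x y. b x y z)"
  note l = tensor_lift[OF A B P ab]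
  note L = linear_mapsD[OF l(1)]
  have smult: "(\<lambda>p. r \<odot>\<^bsub>P\<^esub> p) \<in> linear_maps K P P" if "r \<in> carrier K" for r
  proof (rule linear_mapsI)
    fix s p assume "s \<in> carrier K" "p \<in> carrier P"
    then show "r \<odot>\<^bsub>P\<^esub> (s \<odot>\<^bsub>P\<^esub> p) = s \<odot>\<^bsub>P\<^esub> (r \<odot>\<^bsub>P\<^esub> p)"
      using that by (metis P.smult_assoc1 P.R.m_comm)
  qed (use that in \<open>simp_all add: P.smult_r_distr\<close>)
  show ?thesis
  proof (rule bilinear_mapsI, goal_cases)
    case (3 s y y')
    have "?l (y \<oplus>\<^bsub>C\<^esub> y') s = (\<lambda>s. ?l y s \<oplus>\<^bsub>P\<^esub> ?l y' s) s"
      by (rule linear_maps_eq_on_tensor[OF A B P l(1) linear_maps_add[OF P l(1) l(1)] _ 3(1)])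
        (use 3 in \<open>simp_all add: l(2) linear_mapsD[OF c]\<close>)
    then show ?case by simp
  next
    case (5 r s y)
    have "?l (r \<odot>\<^bsub>C\<^esub> y) s = (\<lambda>s. r \<odot>\<^bsub>P\<^esub> ?l y s) s"
      by (rule linear_maps_eq_on_tensor[OF A B P l(1) linear_maps_comp[OF smult[OF 5(1)] l(1)] _ 5(2)])
        (use 5 in \<open>simp_all add: l(2) linear_mapsD[OF c]\<close>)
    then show ?case by simp
  qed (simp_all add: L)
qed

lemma bilinear_maps_swap:
  "(\<lambda>x y. b y x) \<in> bilinear_maps K M N P \<longleftrightarrow> b \<in> bilinear_maps K N M P"
  by (auto simp: bilinear_maps_def)

lemma tensor_assoc:
  assumes A: "module K A" and B: "module K B" and C: "module K C"
  shows "tensor_assoc K A B C \<in> linear_maps K (tensor_module K (tensor_module K A B) C)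
           (tensor_module K A (tensor_module K B C))"
    "\<lbrakk>x \<in> carrier A; y \<in> carrier B; z \<in> carrier C\<rbrakk> \<Longrightarrow>
      tensor_assoc K A B C (pure_tensor K (tensor_module K A B) C (pure_tensor K A B x y) z)
        = pure_tensor K A (tensor_module K B C) x (pure_tensor K B C y z)"
proof -
  let ?AB = "tensor_module K A B" and ?BC = "tensor_module K B C"
  let ?T = "tensor_module K A ?BC"
  let ?b = "\<lambda>x y z. pure_tensor K A ?BC x (pure_tensor K B C y z)"
  note mods = tensor_module_module(1)
  note p = bilinear_mapsD[OF pure_tensor_bilinear[OF B C]]
    bilinear_mapsD[OF pure_tensor_bilinear[OF A mods[OF B C]]]
  have ab: "(\<lambda>x y. ?b x y z) \<in> bilinear_maps K A B ?T" if "z \<in> carrier C" for z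
    by (rule bilinear_mapsI) (use that in \<open>simp_all add: p\<close>)
  have c: "?b x y \<in> linear_maps K C ?T" if "x \<in> carrier A" "y \<in> carrier B" for x y
    by (rule linear_mapsI) (use that in \<open>simp_all add: p\<close>)
  have T: "module K ?T" by (intro mods A B C)
  have "(\<lambda>s z. tensor_lift K ?T (\<lambda>x y. ?b x y z) s) \<in> bilinear_maps K ?AB C ?T"
    by (rule tensor_lift_bilinear_left[where b = ?b, OF A B T ab c C])
  note * = tensor_lift[OF mods[OF A B] C T this]
  show "tensor_assoc K A B C \<in> linear_maps K (tensor_module K (tensor_module K A B) C)
           (tensor_module K A (tensor_module K B C))"
    unfolding tensor_assoc_def Let_def by (fact *(1))
  assume xyz: "x \<in> carrier A" "y \<in> carrier B" "z \<in> carrier C"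
  show "tensor_assoc K A B C (pure_tensor K (tensor_module K A B) C (pure_tensor K A B x y) z)
        = pure_tensor K A (tensor_module K B C) x (pure_tensor K B C y z)"
    unfolding tensor_assoc_def Let_def using xyz
    by (subst *(2)) (simp_all add: bilinear_mapsD(1)[OF pure_tensor_bilinear[OF A B]]
        tensor_lift(2)[OF A B T ab])
qed

lemma tensor_assoc_inv:
  assumes A: "module K A" and B: "module K B" and C: "module K C"
  shows "tensor_assoc_inv K A B C \<in> linear_maps K (tensor_module K A (tensor_module K B C))
           (tensor_module K (tensor_module K A B) C)"
    "\<lbrakk>x \<in> carrier A; y \<in> carrier B; z \<in> carrier C\<rbrakk> \<Longrightarrow>
      tensor_assoc_inv K A B C (pure_tensor K A (tensor_module K B C) x (pure_tensor K B C y z))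
        = pure_tensor K (tensor_module K A B) C (pure_tensor K A B x y) z"
proof -
  let ?AB = "tensor_module K A B" and ?BC = "tensor_module K B C"
  let ?T = "tensor_module K ?AB C"
  let ?b = "\<lambda>y z x. pure_tensor K ?AB C (pure_tensor K A B x y) z"
  note mods = tensor_module_module(1)
  note p = bilinear_mapsD[OF pure_tensor_bilinear[OF A B]]
    bilinear_mapsD[OF pure_tensor_bilinear[OF mods[OF A B] C]]
  have bc: "(\<lambda>y z. ?b y z x) \<in> bilinear_maps K B C ?T" if "x \<in> carrier A" for x
    by (rule bilinear_mapsI) (use that in \<open>simp_all add: p\<close>)
  have a: "?b y z \<in> linear_maps K A ?T" if "y \<in> carrier B" "z \<in> carrier C" for y z
    by (rule linear_mapsI) (use that in \<open>simp_all add: p\<close>)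
  have T: "module K ?T" by (intro mods A B C)
  have "(\<lambda>x s. tensor_lift K ?T (\<lambda>y z. ?b y z x) s) \<in> bilinear_maps K A ?BC ?T"
    by (subst bilinear_maps_swap) (rule tensor_lift_bilinear_left[where b = ?b, OF B C T bc a A])
  note * = tensor_lift[OF A mods[OF B C] T this]
  show "tensor_assoc_inv K A B C \<in> linear_maps K (tensor_module K A (tensor_module K B C))
           (tensor_module K (tensor_module K A B) C)"
    unfolding tensor_assoc_inv_def Let_def by (fact *(1))
  assume xyz: "x \<in> carrier A" "y \<in> carrier B" "z \<in> carrier C"
  show "tensor_assoc_inv K A B C (pure_tensor K A (tensor_module K B C) x (pure_tensor K B C y z))
        = pure_tensor K (tensor_module K A B) C (pure_tensor K A B x y) z"
    unfolding tensor_assoc_inv_def Let_def using xyz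
    by (subst *(2)) (simp_all add: bilinear_mapsD(1)[OF pure_tensor_bilinear[OF B C]]
        tensor_lift(2)[OF B C T bc])
qed

text \<open>
  Each of the five factors of \<open>\<tau>\<^sub>2\<close> sends a pure tensor to a pure tensor, along
  \<open>(x \<otimes> y) \<otimes> (z \<otimes> w) \<mapsto> x \<otimes> (y \<otimes> (z \<otimes> w)) \<mapsto> x \<otimes> ((y \<otimes> z) \<otimes> w) \<mapsto> x \<otimes> ((z \<otimes> y) \<otimes> w) \<mapsto>
  x \<otimes> (z \<otimes> (y \<otimes> w)) \<mapsto> (x \<otimes> z) \<otimes> (y \<otimes> w)\<close>.
\<close>

lemma tensor_flip2:
  assumes N: "module K N"
  defines "NN \<equiv> tensor_module K N N"
  shows "tensor_flip2 K N \<in> linear_maps K (tensor_module K NN NN) (tensor_module K NN NN)"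
    "\<lbrakk>x \<in> carrier N; y \<in> carrier N; z \<in> carrier N; w \<in> carrier N\<rbrakk> \<Longrightarrow>
      tensor_flip2 K N (pure_tensor K NN NN (pure_tensor K N N x y) (pure_tensor K N N z w))
        = pure_tensor K NN NN (pure_tensor K N N x z) (pure_tensor K N N y w)"
proof -
  let ?NN = "tensor_module K N N"
  let ?l = "tensor_module K ?NN N" and ?r = "tensor_module K N ?NN"
  note mods = tensor_module_module(1)
  note NN = mods[OF N N]
  note l = mods[OF NN N] and r = mods[OF N NN]
  note flip = tensor_map[OF NN N NN N tensor_flip(1)[OF N N] linear_maps_id]
  note f1 = tensor_assoc[OF N N NN]
    and f2 = tensor_map[OF N r N l linear_maps_id tensor_assoc_inv(1)[OF N N N]]
    and f3 = tensor_map[OF N l N l linear_maps_id flip(1)]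
    and f4 = tensor_map[OF N l N r linear_maps_id tensor_assoc(1)[OF N N N]]
    and f5 = tensor_assoc_inv[OF N N NN]
  show "tensor_flip2 K N \<in> linear_maps K (tensor_module K NN NN) (tensor_module K NN NN)"
    unfolding tensor_flip2_def Let_def comp_def NN_def
    by (rule linear_maps_comp[OF f5(1) linear_maps_comp[OF f4(1) linear_maps_comp[OF f3(1)
          linear_maps_comp[OF f2(1) f1(1)]]]])
  assume "x \<in> carrier N" "y \<in> carrier N" "z \<in> carrier N" "w \<in> carrier N"
  then show "tensor_flip2 K N (pure_tensor K NN NN (pure_tensor K N N x y) (pure_tensor K N N z w))
        = pure_tensor K NN NN (pure_tensor K N N x z) (pure_tensor K N N y w)"
    unfolding tensor_flip2_def Let_def NN_def
    by (simp add: f1(2) f2(2) f3(2) f4(2) f5(2) flip(2) tensor_flip(2)[OF N N]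
        tensor_assoc(2)[OF N N N] tensor_assoc_inv(2)[OF N N N]
        bilinear_mapsD(1)[OF pure_tensor_bilinear[OF N N]]
        bilinear_mapsD(1)[OF pure_tensor_bilinear[OF N NN]]
        bilinear_mapsD(1)[OF pure_tensor_bilinear[OF NN N]])
qed


section \<open>The coalgebra of a Lie algebra\<close>

lemma direct_sum_module_simps [simp]:
  "carrier (direct_sum_module M N) = carrier M \<times> carrier N"
  "\<zero>\<^bsub>direct_sum_module M N\<^esub> = (\<zero>\<^bsub>M\<^esub>, \<zero>\<^bsub>N\<^esub>)"
  "(x, y) \<oplus>\<^bsub>direct_sum_module M N\<^esub> (x', y') = (x \<oplus>\<^bsub>M\<^esub> x', y \<oplus>\<^bsub>N\<^esub> y')"
  "r \<odot>\<^bsub>direct_sum_module M N\<^esub> (x, y) = (r \<odot>\<^bsub>M\<^esub> x, r \<odot>\<^bsub>N\<^esub> y)"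
  by (simp_all add: direct_sum_module_def)

lemma scalar_module_simps [simp]:
  "carrier (scalar_module K) = carrier K"
  "\<zero>\<^bsub>scalar_module K\<^esub> = \<zero>\<^bsub>K\<^esub>"
  "x \<oplus>\<^bsub>scalar_module K\<^esub> y = x \<oplus>\<^bsub>K\<^esub> y"
  "r \<odot>\<^bsub>scalar_module K\<^esub> x = r \<otimes>\<^bsub>K\<^esub> x"
  by (simp_all add: scalar_module_def)

lemma direct_sum_module_module:
  assumes M: "module K M" and N: "module K N"
  shows "module K (direct_sum_module M N)"
proof -
  interpret M: module K M by fact
  interpret N: module K N by fact
  have "abelian_group (direct_sum_module M N)"
  proof (rule abelian_groupI)
    fix x assume "x \<in> carrier (direct_sum_module M N)"
    then show "\<exists>y\<in>carrier (direct_sum_module M N). y \<oplus>\<^bsub>direct_sum_module M N\<^esub> x = \<zero>\<^bsub>direct_sum_module M N\<^esub>"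
      by (intro bexI[of _ "(\<ominus>\<^bsub>M\<^esub> fst x, \<ominus>\<^bsub>N\<^esub> snd x)"]) (auto simp: M.l_neg N.l_neg)
  qed (auto simp: M.a_ac N.a_ac)
  then show ?thesis
    by (rule moduleI[OF M.R.is_cring])
      (auto simp: M.smult_l_distr N.smult_l_distr M.smult_r_distr N.smult_r_distr
        M.smult_assoc1 N.smult_assoc1)
qed

lemma scalar_module_module:
  assumes "cring K" shows "module K (scalar_module K)"
proof -
  interpret cring K by fact
  have "abelian_group (scalar_module K)"
  proof (rule abelian_groupI)
    fix x assume "x \<in> carrier (scalar_module K)"
    then show "\<exists>y\<in>carrier (scalar_module K). y \<oplus>\<^bsub>scalar_module K\<^esub> x = \<zero>\<^bsub>scalar_module K\<^esub>"
      by (intro bexI[of _ "\<ominus>\<^bsub>K\<^esub> x"]) (auto simp: l_neg)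
  qed (auto simp: a_ac)
  then show ?thesis
    by (rule moduleI[OF assms]) (auto simp: l_distr r_distr m_assoc)
qed

context lie_algebra
begin

abbreviation (input) N where "N \<equiv> shelf_module K L"
abbreviation (input) NN where "NN \<equiv> tensor_module K N N"
abbreviation (input) pt where "pt \<equiv> pure_tensor K N N"
abbreviation (input) pt2 where "pt2 \<equiv> pure_tensor K NN NN"
abbreviation (input) unit where "unit \<equiv> (\<one>, \<zero>\<^bsub>L\<^esub>)"

lemma shelf_module_simps [simp]:
  "carrier N = carrier K \<times> carrier L"
  "\<zero>\<^bsub>N\<^esub> = (\<zero>, \<zero>\<^bsub>L\<^esub>)"
  "(a, u) \<oplus>\<^bsub>N\<^esub> (b, v) = (a \<oplus> b, u \<oplus>\<^bsub>L\<^esub> v)"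
  "r \<odot>\<^bsub>N\<^esub> (a, u) = (r \<otimes> a, r \<odot>\<^bsub>L\<^esub> u)"
  by (simp_all add: shelf_module_def)

lemma shelf_modules: "module K N" "module K NN" "module K (tensor_module K NN NN)"
proof -
  show "module K N"
    unfolding shelf_module_def
    by (intro direct_sum_module_module scalar_module_module is_cring module_axioms)
  then show "module K NN" "module K (tensor_module K NN NN)"
    by (auto intro: tensor_module_module(1))
qed

lemma shelf_minus:
  assumes "a \<in> carrier K" "u \<in> carrier L" "b \<in> carrier K" "v \<in> carrier L"
  shows "(a, u) \<ominus>\<^bsub>N\<^esub> (b, v) = (a \<ominus> b, u \<ominus>\<^bsub>L\<^esub> v)"
proof -
  interpret N: module K N by (rule shelf_modules)
  have "\<ominus>\<^bsub>N\<^esub> (b, v) = (\<ominus> b, \<ominus>\<^bsub>L\<^esub> v)"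
    using assms by (intro N.minus_equality) (simp_all add: abelian_group.l_neg[OF is_abelian_group] M.l_neg)
  then show ?thesis by (simp add: a_minus_def)
qed

lemmas bracket_rules = bilinear_mapsD[OF bracket_bilinear]
  bilinear_maps_zero[OF module_axioms module_axioms module_axioms bracket_bilinear]

lemma shelf_op:
  shows "shelf_op K L \<in> linear_maps K NN N"
    and "\<lbrakk>a \<in> carrier K; u \<in> carrier L; b \<in> carrier K; v \<in> carrier L\<rbrakk> \<Longrightarrow>
      shelf_op K L (pt (a, u) (b, v)) = (a \<otimes> b, b \<odot>\<^bsub>L\<^esub> u \<oplus>\<^bsub>L\<^esub> bracket L u v)"
proof -
  have "(\<lambda>(a, u) (b, v). (a \<otimes> b, b \<odot>\<^bsub>L\<^esub> u \<oplus>\<^bsub>L\<^esub> bracket L u v)) \<in> bilinear_maps K N N N"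
    by (rule bilinear_mapsI)
      (auto simp: bracket_rules l_distr r_distr smult_l_distr smult_r_distr smult_assoc1 M.a_ac m_ac
        smult_assoc1[symmetric] simp del: smult_assoc1)
  note * = tensor_lift[OF shelf_modules(1) shelf_modules(1) shelf_modules(1) this]
  show "shelf_op K L \<in> linear_maps K NN N" unfolding shelf_op_def by (fact *(1))
  show "\<lbrakk>a \<in> carrier K; u \<in> carrier L; b \<in> carrier K; v \<in> carrier L\<rbrakk> \<Longrightarrow>
      shelf_op K L (pt (a, u) (b, v)) = (a \<otimes> b, b \<odot>\<^bsub>L\<^esub> u \<oplus>\<^bsub>L\<^esub> bracket L u v)"
    unfolding shelf_op_def by (subst *(2)) auto
qed

lemma shelf_hat:
  assumes "\<phi> \<in> bilinear_maps K L L L"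
  shows "shelf_hat K L \<phi> \<in> linear_maps K NN N"
    and "\<lbrakk>a \<in> carrier K; u \<in> carrier L; b \<in> carrier K; v \<in> carrier L\<rbrakk> \<Longrightarrow>
      shelf_hat K L \<phi> (pt (a, u) (b, v)) = (\<zero>, \<phi> u v)"
proof -
  have "(\<lambda>(a, u) (b, v). (\<zero>, \<phi> u v)) \<in> bilinear_maps K N N N"
    by (rule bilinear_mapsI) (auto simp: bilinear_mapsD[OF assms])
  note * = tensor_lift[OF shelf_modules(1) shelf_modules(1) shelf_modules(1) this]
  show "shelf_hat K L \<phi> \<in> linear_maps K NN N" unfolding shelf_hat_def by (fact *(1))
  show "\<lbrakk>a \<in> carrier K; u \<in> carrier L; b \<in> carrier K; v \<in> carrier L\<rbrakk> \<Longrightarrow>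
      shelf_hat K L \<phi> (pt (a, u) (b, v)) = (\<zero>, \<phi> u v)"
    unfolding shelf_hat_def by (subst *(2)) auto
qed

lemma shelf_comult_eq:
  "shelf_comult K L (a, u) = a \<odot>\<^bsub>NN\<^esub> pt unit unit \<oplus>\<^bsub>NN\<^esub> (pt (\<zero>, u) unit \<oplus>\<^bsub>NN\<^esub> pt unit (\<zero>, u))"
  by (simp add: shelf_comult_def Let_def)

text \<open>
  In \<open>\<Delta>(a + u) = a (1 \<otimes> 1) + (u \<otimes> 1 + 1 \<otimes> u)\<close> each summand is a composite of a coordinate projection
  with a map that is linear because \<open>\<otimes>\<close> is bilinear.
\<close>

lemma shelf_comult_linear: "shelf_comult K L \<in> linear_maps K N NN"
proof -
  interpret NN: module K NN by (rule shelf_modules)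
  note bil = pure_tensor_bilinear[OF shelf_modules(1) shelf_modules(1)]
  have unit: "unit \<in> carrier N" by simp
  have scal: "(\<lambda>x. fst x \<odot>\<^bsub>NN\<^esub> pt unit unit) \<in> linear_maps K N NN"
    by (rule linear_mapsI) (auto simp: NN.smult_l_distr NN.smult_assoc1 bilinear_mapsD(1)[OF bil])
  have prim: "(\<lambda>x. (\<zero>, snd x)) \<in> linear_maps K N N"
    by (rule linear_mapsI) auto
  note lin = linear_maps_add[OF NN.module_axioms scal linear_maps_add[OF NN.module_axioms
      linear_maps_comp[OF bilinear_maps_linear(2)[OF bil unit] prim]
      linear_maps_comp[OF bilinear_maps_linear(1)[OF bil unit] prim]]]
  have "shelf_comult K L = (\<lambda>x. fst x \<odot>\<^bsub>NN\<^esub> pt unit unit \<oplus>\<^bsub>NN\<^esub>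
      (pt (\<zero>, snd x) unit \<oplus>\<^bsub>NN\<^esub> pt unit (\<zero>, snd x)))"
    by (auto simp: fun_eq_iff shelf_comult_eq)
  then show ?thesis using lin by simp
qed

lemmas pt_rules = bilinear_mapsD[OF pure_tensor_bilinear[OF shelf_modules(1) shelf_modules(1)]]
lemmas pt_zero = bilinear_maps_zero[OF shelf_modules(1) shelf_modules(1) shelf_modules(2)
    pure_tensor_bilinear[OF shelf_modules(1) shelf_modules(1)]]
lemmas pt2_rules = bilinear_mapsD[OF pure_tensor_bilinear[OF shelf_modules(2) shelf_modules(2)]]
lemmas shelf_map = tensor_map[OF shelf_modules(2) shelf_modules(2) shelf_modules(1) shelf_modules(1)]


section \<open>The differentials of the map induced by a bilinear map\<close>

lemma shelf_d21_linear:
  assumes \<eta>: "\<eta> \<in> linear_maps K NN N"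
  shows "shelf_d21 K L \<eta> \<in> linear_maps K (tensor_module K NN N) N"
proof -
  note m = shelf_modules
  note q = shelf_op(1)
  note outer = tensor_map(1)[OF m(2) m(1) m(1) m(1) _ linear_maps_id]
  note mix = linear_maps_comp[OF tensor_flip2(1)[OF m(1)] tensor_map(1)[OF m(2) m(1) m(2) m(2)
        tensor_map(1)[OF m(1) m(1) m(1) m(1) linear_maps_id linear_maps_id] shelf_comult_linear]]
  note tm = linear_maps_comp[OF _ linear_maps_comp[OF shelf_map(1) mix]]
  note add = linear_maps_add[OF m(1)]
  show ?thesis
    unfolding shelf_d21_def Let_def
    by (rule linear_maps_diff[OF m(1) add[OF linear_maps_comp[OF q outer[OF \<eta>]] linear_maps_comp[OF \<eta> outer[OF q]]]
          add[OF add[OF tm[OF \<eta> q q] tm[OF q \<eta> q]] tm[OF q q \<eta>]]])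
qed

lemma shelf_d22_linear:
  assumes \<eta>: "\<eta> \<in> linear_maps K NN N"
  shows "shelf_d22 K L \<eta> \<in> linear_maps K NN NN"
proof -
  note m = shelf_modules
  note q = shelf_op(1) and D = shelf_comult_linear
  note mix = linear_maps_comp[OF tensor_flip2(1)[OF m(1)] tensor_map(1)[OF m(1) m(1) m(2) m(2) D D]]
  note tm = linear_maps_comp[OF shelf_map(1) mix]
  show ?thesis
    unfolding shelf_d22_def Let_def
    by (rule linear_maps_diff[OF m(2) linear_maps_comp[OF D \<eta>]
          linear_maps_add[OF m(2) tm[OF \<eta> q] tm[OF q \<eta>]]])
qed

text \<open>
  On \<open>((a + u) \<otimes> (b + v)) \<otimes> (c + w)\<close> the scalars \<open>a\<close>, \<open>b\<close>, \<open>c\<close> leave no trace.  The scalar \<open>a\<close> is either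
  discarded by \<open>\<phi>\<close> or multiplied by the scalar part of a value of \<open>\<phi>\<close>, which is zero.  The group-like part \<open>c\<close> of the last factor contributes
  \<open>c \<phi>(u, v)\<close> to both sides of the difference, since \<open>1\<close> acts as a right identity and pairs to zero
  under \<open>\<phi>\<close>; the scalar \<open>b\<close> contributes \<open>b \<phi>(u, w)\<close> to both sides in the same manner.  What remains is
  the failure of \<open>[\<cdot>, w] + \<epsilon> \<phi>(\<cdot>, w)\<close> to be a derivation to first order in \<open>\<epsilon>\<close>; for alternating \<open>\<phi>\<close> it is
  the Chevalley-Eilenberg differential with adjoint coefficients, up to sign.
\<close>

lemma shelf_d21_pure:
  assumes \<phi>: "\<phi> \<in> bilinear_maps K L L L"
    and "a \<in> carrier K" "u \<in> carrier L" "b \<in> carrier K" "v \<in> carrier L" "c \<in> carrier K" "w \<in> carrier L"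
  shows "shelf_d21 K L (shelf_hat K L \<phi>) (pure_tensor K NN N (pt (a, u) (b, v)) (c, w))
    = (\<zero>, (bracket L (\<phi> u v) w \<oplus>\<^bsub>L\<^esub> \<phi> (bracket L u v) w) \<ominus>\<^bsub>L\<^esub>
        (\<phi> (bracket L u w) v \<oplus>\<^bsub>L\<^esub> \<phi> u (bracket L v w) \<oplus>\<^bsub>L\<^esub> bracket L (\<phi> u w) v \<oplus>\<^bsub>L\<^esub> bracket L u (\<phi> v w)))"
    (is "?d = (\<zero>, ?r)")
proof -
  interpret N: module K N by (rule shelf_modules)
  interpret NN: module K NN by (rule shelf_modules)
  interpret NNNN: module K "tensor_module K NN NN" by (rule shelf_modules)
  let ?\<eta> = "shelf_hat K L \<phi>" and ?q = "shelf_op K L"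
  note m = shelf_modules
  note \<eta> = shelf_hat[OF \<phi>] and q = shelf_op
  let ?x = "(a, u)" and ?y = "(b, v)" and ?w = "(\<zero>, w)"
  let ?s = "c \<odot>\<^bsub>tensor_module K NN NN\<^esub> pt2 (pt ?x unit) (pt ?y unit) \<oplus>\<^bsub>tensor_module K NN NN\<^esub>
    (pt2 (pt ?x ?w) (pt ?y unit) \<oplus>\<^bsub>tensor_module K NN NN\<^esub> pt2 (pt ?x unit) (pt ?y ?w))"
  note phi = bilinear_mapsD[OF \<phi>] bilinear_maps_zero[OF module_axioms module_axioms module_axioms \<phi>]
  note outer = tensor_map(2)[OF m(2) m(1) m(1) m(1) _ linear_maps_id]
  note D = tensor_map(2)[OF m(2) m(1) m(2) m(2) tensor_map(1)[OF m(1) m(1) m(1) m(1) linear_maps_id linear_maps_id]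
     shelf_comult_linear]
  note flip = linear_mapsD[OF tensor_flip2(1)[OF m(1)]] tensor_flip2(2)[OF m(1)]
  (* Comultiplying the last factor: c (1 \<otimes> 1) + w \<otimes> 1 + 1 \<otimes> w, its legs distributed over x and y. *)
  have s: "tensor_flip2 K N (tensor_map K NN NN (tensor_map K N N id id) (shelf_comult K L)
      (pure_tensor K NN N (pt ?x ?y) (c, w))) = ?s"
    using assms by (simp add: D pt_rules(1) tensor_map_id[OF m(1) m(1)] shelf_comult_eq pt2_rules
        linear_mapsD(1)[OF shelf_comult_linear]flip)
  (* The three subtracted terms of the differential are instances of one composite. *)
  have T: "g (tensor_map K N N f h ?s) = c \<odot>\<^bsub>N\<^esub> g (pt (f (pt ?x unit)) (h (pt ?y unit))) \<oplus>\<^bsub>N\<^esub>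
      (g (pt (f (pt ?x ?w)) (h (pt ?y unit))) \<oplus>\<^bsub>N\<^esub> g (pt (f (pt ?x unit)) (h (pt ?y ?w))))"
    if "f \<in> linear_maps K NN N" "g \<in> linear_maps K NN N" "h \<in> linear_maps K NN N" for f g h
  proof -
    note lin = linear_maps_comp[OF that(2) shelf_map(1)[OF that(1,3)]]
    show ?thesis
      using assms by (simp add: linear_mapsD[OF lin] shelf_map(2)[OF that(1,3)] pt_rules(1)pt2_rules(1))
  qed
  have "?d = ((\<zero>, c \<odot>\<^bsub>L\<^esub> \<phi> u v \<oplus>\<^bsub>L\<^esub> bracket L (\<phi> u v) w) \<oplus>\<^bsub>N\<^esub> (\<zero>, b \<odot>\<^bsub>L\<^esub> \<phi> u w \<oplus>\<^bsub>L\<^esub> \<phi> (bracket L u v) w)) \<ominus>\<^bsub>N\<^esub>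
     ((\<zero>, c \<odot>\<^bsub>L\<^esub> \<phi> u v \<oplus>\<^bsub>L\<^esub> (\<phi> (bracket L u w) v \<oplus>\<^bsub>L\<^esub> \<phi> u (bracket L v w))) \<oplus>\<^bsub>N\<^esub>
      (\<zero>, b \<odot>\<^bsub>L\<^esub> \<phi> u w \<oplus>\<^bsub>L\<^esub> bracket L (\<phi> u w) v) \<oplus>\<^bsub>N\<^esub> (\<zero>, bracket L u (\<phi> v w)))"
    unfolding shelf_d21_def Let_def s
    using assms by (simp add: T \<eta> q outer pt_rules(1) phi bracket_rules)
  also have "\<dots> = (\<zero>, (c \<odot>\<^bsub>L\<^esub> \<phi> u v \<oplus>\<^bsub>L\<^esub> b \<odot>\<^bsub>L\<^esub> \<phi> u w) \<oplus>\<^bsub>L\<^esub> (bracket L (\<phi> u v) w \<oplus>\<^bsub>L\<^esub> \<phi> (bracket L u v) w) \<ominus>\<^bsub>L\<^esub>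
     ((c \<odot>\<^bsub>L\<^esub> \<phi> u v \<oplus>\<^bsub>L\<^esub> b \<odot>\<^bsub>L\<^esub> \<phi> u w) \<oplus>\<^bsub>L\<^esub>
      (\<phi> (bracket L u w) v \<oplus>\<^bsub>L\<^esub> \<phi> u (bracket L v w) \<oplus>\<^bsub>L\<^esub> bracket L (\<phi> u w) v \<oplus>\<^bsub>L\<^esub> bracket L u (\<phi> v w))))"
    using assms by (simp add: shelf_minus abelian_group.minus_eq_zero_iff[OF is_abelian_group] phi(1) bracket_rules(1) M.a_ac)
  also have "\<dots> = (\<zero>, ?r)"
    using assms by (subst M.add_diff_cancel_left) (simp_all add: phi(1) bracket_rules(1))
  finally show ?thesis .
qed

text \<open>
  The image of \<open>\<phi>\<close> consists of primitive elements, so the comultiplication of the value is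
  \<open>\<phi>(u, v) \<otimes> 1 + 1 \<otimes> \<phi>(u, v)\<close>.  Of the nine terms of \<open>\<Delta>(a + u) \<otimes> \<Delta>(b + v)\<close> only those survive whose
  nontrivial legs both reach the factor that carries \<open>\<phi>\<close>, because \<open>\<phi>\<close> vanishes when one argument is
  \<open>1\<close>: they are \<open>(u \<otimes> 1) \<otimes> (v \<otimes> 1)\<close> for \<open>\<eta> \<otimes> q\<close> and \<open>(1 \<otimes> u) \<otimes> (1 \<otimes> v)\<close> for \<open>q \<otimes> \<eta>\<close>.
\<close>

lemma shelf_d22_pure:
  assumes \<phi>: "\<phi> \<in> bilinear_maps K L L L"
    and "a \<in> carrier K" "u \<in> carrier L" "b \<in> carrier K" "v \<in> carrier L"
  shows "shelf_d22 K L (shelf_hat K L \<phi>) (pt (a, u) (b, v)) = \<zero>\<^bsub>NN\<^esub>"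
proof -
  interpret N: module K N by (rule shelf_modules)
  interpret NN: module K NN by (rule shelf_modules)
  interpret NNNN: module K "tensor_module K NN NN" by (rule shelf_modules)
  let ?\<eta> = "shelf_hat K L \<phi>" and ?q = "shelf_op K L"
  note m = shelf_modules
  note \<eta> = shelf_hat[OF \<phi>] and q = shelf_op
  note phi = bilinear_mapsD[OF \<phi>] bilinear_maps_zero[OF module_axioms module_axioms module_axioms \<phi>]
  note D = tensor_map(2)[OF m(1) m(1) m(2) m(2) shelf_comult_linear shelf_comult_linear]
  note flip = linear_mapsD[OF tensor_flip2(1)[OF m(1)]] tensor_flip2(2)[OF m(1)]
  let ?e = unit and ?u = "(\<zero>, u)" and ?v = "(\<zero>, v)"
  let ?P = "\<lambda>x x' y y'. pt2 (pt x y) (pt x' y')"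
  have s: "tensor_flip2 K N (tensor_map K NN NN (shelf_comult K L) (shelf_comult K L) (pt (a, u) (b, v))) =
    b \<odot>\<^bsub>tensor_module K NN NN\<^esub> (a \<odot>\<^bsub>tensor_module K NN NN\<^esub> ?P ?e ?e ?e ?e \<oplus>\<^bsub>tensor_module K NN NN\<^esub>
        (?P ?u ?e ?e ?e \<oplus>\<^bsub>tensor_module K NN NN\<^esub> ?P ?e ?u ?e ?e)) \<oplus>\<^bsub>tensor_module K NN NN\<^esub>
     ((a \<odot>\<^bsub>tensor_module K NN NN\<^esub> ?P ?e ?e ?v ?e \<oplus>\<^bsub>tensor_module K NN NN\<^esub>
        (?P ?u ?e ?v ?e \<oplus>\<^bsub>tensor_module K NN NN\<^esub> ?P ?e ?u ?v ?e)) \<oplus>\<^bsub>tensor_module K NN NN\<^esub>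
      (a \<odot>\<^bsub>tensor_module K NN NN\<^esub> ?P ?e ?e ?e ?v \<oplus>\<^bsub>tensor_module K NN NN\<^esub>
        (?P ?u ?e ?e ?v \<oplus>\<^bsub>tensor_module K NN NN\<^esub> ?P ?e ?u ?e ?v)))" (is "_ = ?s")
    using assms by (simp add: D pt_rules(1) shelf_comult_eq pt2_rules flip NNNN.smult_r_distr)
  have \<eta>q: "tensor_map K N N ?\<eta> ?q ?s = pt (\<zero>, \<phi> u v) ?e"
    using assms by (simp add: linear_mapsD[OF shelf_map(1)[OF \<eta>(1) q(1)]] shelf_map(2)[OF \<eta>(1) q(1)]
      \<eta>(2) q(2) phi bracket_rules pt_rules(1) pt2_rules(1) pt_zero[simplified])
  have q\<eta>: "tensor_map K N N ?q ?\<eta> ?s = pt ?e (\<zero>, \<phi> u v)"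
    using assms by (simp add: linear_mapsD[OF shelf_map(1)[OF q(1) \<eta>(1)]] shelf_map(2)[OF q(1) \<eta>(1)]
      \<eta>(2) q(2) phi bracket_rules pt_rules(1) pt2_rules(1) pt_zero[simplified])
  have "shelf_comult K L (?\<eta> (pt (a, u) (b, v))) = pt (\<zero>, \<phi> u v) ?e \<oplus>\<^bsub>NN\<^esub> pt ?e (\<zero>, \<phi> u v)"
    using assms by (simp add: \<eta>(2) shelf_comult_eq pt_rules(1) phi)
  then show ?thesis
    unfolding shelf_d22_def Let_def s \<eta>q q\<eta>
    using assms by (simp add: pt_rules(1) phi NN.minus_eq_zero_iff)
qed

text \<open>
  The hypothesis says that \<open>[\<cdot>, \<cdot>] + \<epsilon> \<phi>\<close> satisfies the Jacobi identity, in the form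
  \<open>[[u, v], w] = [[u, w], v] + [u, [v, w]]\<close>, to first order in \<open>\<epsilon>\<close>.
\<close>

theorem shelf_hat_2_cocycle:
  assumes \<phi>: "\<phi> \<in> bilinear_maps K L L L"
    and cocycle: "\<And>u v w. \<lbrakk>u \<in> carrier L; v \<in> carrier L; w \<in> carrier L\<rbrakk> \<Longrightarrow>
      bracket L (\<phi> u v) w \<oplus>\<^bsub>L\<^esub> \<phi> (bracket L u v) w =
        \<phi> (bracket L u w) v \<oplus>\<^bsub>L\<^esub> \<phi> u (bracket L v w) \<oplus>\<^bsub>L\<^esub> bracket L (\<phi> u w) v \<oplus>\<^bsub>L\<^esub> bracket L u (\<phi> v w)"
  shows "shelf_2_cocycle K L (shelf_hat K L \<phi>)"
proof -
  note m = shelf_modules and \<eta> = shelf_hat(1)[OF \<phi>]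
  note closed = bilinear_mapsD(1)[OF \<phi>] bracket_rules(1)
  have "shelf_d21 K L (shelf_hat K L \<phi>) t = \<zero>\<^bsub>N\<^esub>" if "t \<in> carrier (tensor_module K NN N)" for t
  proof (rule linear_maps_eq_on_tensor3[OF m(1) m(1) m(1) m(1) shelf_d21_linear[OF \<eta>]
        linear_maps_const_zero[OF m(1)] _ that])
    fix x y z assume "x \<in> carrier N" "y \<in> carrier N" "z \<in> carrier N"
    then show "shelf_d21 K L (shelf_hat K L \<phi>) (pure_tensor K NN N (pt x y) z) = \<zero>\<^bsub>N\<^esub>"
      using cocycle closed by (auto simp: shelf_d21_pure[OF \<phi>] M.minus_eq_zero_iff)
  qed
  moreover have "shelf_d22 K L (shelf_hat K L \<phi>) t = \<zero>\<^bsub>NN\<^esub>" if "t \<in> carrier NN" for t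
  proof (rule linear_maps_eq_on_tensor[OF m(1) m(1) m(2) shelf_d22_linear[OF \<eta>]
        linear_maps_const_zero[OF m(2)] _ that])
    fix x y assume "x \<in> carrier N" "y \<in> carrier N"
    then show "shelf_d22 K L (shelf_hat K L \<phi>) (pt x y) = \<zero>\<^bsub>NN\<^esub>"
      by (auto simp: shelf_d22_pure[OF \<phi>])
  qed
  ultimately show ?thesis using \<eta> by (simp add: shelf_2_cocycle_def Let_def)
qed

lemma bracket_skew:
  assumes "x \<in> carrier L" "y \<in> carrier L"
  shows "bracket L y x = \<ominus>\<^bsub>L\<^esub> bracket L x y"
proof -
  have "bracket L y x \<oplus>\<^bsub>L\<^esub> bracket L x y = bracket L (x \<oplus>\<^bsub>L\<^esub> y) (x \<oplus>\<^bsub>L\<^esub> y)"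
    using assms by (simp add: bracket_rules bracket_self[of x] bracket_self[of y] M.a_ac)
  also have "\<dots> = \<zero>\<^bsub>L\<^esub>" using assms by (simp add: bracket_self)
  finally have "bracket L y x \<oplus>\<^bsub>L\<^esub> bracket L x y = \<zero>\<^bsub>L\<^esub>" .
  then show ?thesis using assms M.minus_equality bracket_rules(1) by metis
qed

end


section \<open>Scalar cocycles and the central extension\<close>

lemma gamma_extension_simps [simp]:
  "carrier (gamma_extension K L) = carrier K \<times> carrier L"
  "\<zero>\<^bsub>gamma_extension K L\<^esub> = (\<zero>\<^bsub>K\<^esub>, \<zero>\<^bsub>L\<^esub>)"
  "(a, x) \<oplus>\<^bsub>gamma_extension K L\<^esub> (b, y) = (a \<oplus>\<^bsub>K\<^esub> b, x \<oplus>\<^bsub>L\<^esub> y)"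
  "r \<odot>\<^bsub>gamma_extension K L\<^esub> (a, x) = (r \<otimes>\<^bsub>K\<^esub> a, r \<odot>\<^bsub>L\<^esub> x)"
  "bracket (gamma_extension K L) (a, x) (b, y) = (\<zero>\<^bsub>K\<^esub>, bracket L x y)"
  by (simp_all add: gamma_extension_def module.defs direct_sum_module_def scalar_module_def)

theorem theorem7p7:
  fixes K :: "('k, 'r) ring_scheme"
    and L :: "('k, 'g, 's) lie_structure_scheme"
    and \<psi> :: "'g \<Rightarrow> 'g \<Rightarrow> 'k"
  assumes "field K"
    and "\<one>\<^bsub>K\<^esub> \<oplus>\<^bsub>K\<^esub> \<one>\<^bsub>K\<^esub> \<noteq> \<zero>\<^bsub>K\<^esub>"
    and "lie_algebra K L"
    and "\<psi> \<in> bilinear_maps K L L (scalar_module K)"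
    and "\<And>x y. \<lbrakk>x \<in> carrier L; y \<in> carrier L\<rbrakk> \<Longrightarrow> \<psi> y x = \<ominus>\<^bsub>K\<^esub> \<psi> x y"
    and "\<And>x y z. \<lbrakk>x \<in> carrier L; y \<in> carrier L; z \<in> carrier L\<rbrakk> \<Longrightarrow>
           \<psi> (bracket L x y) z \<oplus>\<^bsub>K\<^esub> \<psi> (bracket L y z) x \<oplus>\<^bsub>K\<^esub> \<psi> (bracket L z x) y = \<zero>\<^bsub>K\<^esub>"
  shows "shelf_2_cocycle K (gamma_extension K L)
           (shelf_hat K (gamma_extension K L) (gamma_form L \<psi>))"
proof -
  interpret K: abelian_group K using assms(1) by (simp add: field_def domain_def cring_def ring_def)
  interpret lie_algebra K L by fact
  note bl = bilinear_mapsD[OF assms(4), simplified]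
  have zero: "\<psi> \<zero>\<^bsub>L\<^esub> x = \<zero>\<^bsub>K\<^esub>" "\<psi> x \<zero>\<^bsub>L\<^esub> = \<zero>\<^bsub>K\<^esub>" if "x \<in> carrier L" for x
    using bilinear_maps_zero[OF module_axioms module_axioms scalar_module_module[OF is_cring] assms(4)] that
    by simp_all
  have closed: "bracket L x y \<in> carrier L" if "x \<in> carrier L" "y \<in> carrier L" for x y
    using bracket_rules(1) that .
  have neg: "\<psi> (\<ominus>\<^bsub>L\<^esub> x) y = \<ominus>\<^bsub>K\<^esub> \<psi> x y" if "x \<in> carrier L" "y \<in> carrier L" for x y
  proof -
    have "\<psi> (\<ominus>\<^bsub>L\<^esub> x) y \<oplus>\<^bsub>K\<^esub> \<psi> x y = \<psi> (\<ominus>\<^bsub>L\<^esub> x \<oplus>\<^bsub>L\<^esub> x) y"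
      using that by (simp add: bl(2))
    also have "\<dots> = \<zero>\<^bsub>K\<^esub>" using that by (simp add: M.l_neg zero)
    finally show ?thesis using that K.minus_equality by (simp add: bl(1))
  qed
  (* Skew-symmetry of \<psi> and of the bracket turns the cyclic cocycle condition into a derivation law. *)
  have key: "\<psi> (bracket L x y) z = \<psi> (bracket L x z) y \<oplus>\<^bsub>K\<^esub> \<psi> x (bracket L y z)"
    if "x \<in> carrier L" "y \<in> carrier L" "z \<in> carrier L" for x y z
  proof -
    have "\<psi> (bracket L z x) y = \<ominus>\<^bsub>K\<^esub> \<psi> (bracket L x z) y"
      using that by (simp add: bracket_skew[of x z] neg closed)
    moreover have "\<psi> (bracket L y z) x = \<ominus>\<^bsub>K\<^esub> \<psi> x (bracket L y z)"
      using that by (intro assms(5) closed)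
    ultimately have "\<psi> (bracket L x y) z \<ominus>\<^bsub>K\<^esub> (\<psi> (bracket L x z) y \<oplus>\<^bsub>K\<^esub> \<psi> x (bracket L y z)) = \<zero>\<^bsub>K\<^esub>"
      using assms(6)[OF that] that by (simp add: K.minus_eq K.minus_add bl(1) closed K.a_ac)
    then show ?thesis using that by (simp add: K.minus_eq_zero_iff bl(1) closed)
  qed
  (* The values of the form are multiples of \<gamma>, which is central, so every bracket with a value is zero. *)
  show ?thesis
  proof (rule lie_algebra.shelf_hat_2_cocycle[OF gamma_extension_lie[OF assms(3)]])
    show "gamma_form L \<psi> \<in> bilinear_maps K (gamma_extension K L) (gamma_extension K L) (gamma_extension K L)"
      by (rule bilinear_mapsI) (auto simp: gamma_form_def bl)
  next
    fix u v w
    assume "u \<in> carrier (gamma_extension K L)" "v \<in> carrier (gamma_extension K L)"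
      "w \<in> carrier (gamma_extension K L)"
    then obtain a x b y c z where eq: "u = (a, x)" "v = (b, y)" "w = (c, z)"
      and xyz: "x \<in> carrier L" "y \<in> carrier L" "z \<in> carrier L"
      by auto
    let ?L = "gamma_extension K L" and ?\<phi> = "gamma_form L \<psi>"
    show "bracket ?L (?\<phi> u v) w \<oplus>\<^bsub>?L\<^esub> ?\<phi> (bracket ?L u v) w =
      ?\<phi> (bracket ?L u w) v \<oplus>\<^bsub>?L\<^esub> ?\<phi> u (bracket ?L v w) \<oplus>\<^bsub>?L\<^esub> bracket ?L (?\<phi> u w) v \<oplus>\<^bsub>?L\<^esub> bracket ?L u (?\<phi> v w)"
      using key[OF xyz] xyz by (simp add: eq gamma_form_def bl(1) closed bracket_rules(6,7))
  qed
qed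

end
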